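(* If $p$ is a generalized Hecke path in $V$ with $p(0)=0$, then $k_R\cdot p$, the image of $p$ under dilation by $k_R$, is a generalized LS path of $\Delta$-length equal to $k_R\,\mathrm{length}_\Delta(p)$.
   Context: Let $R$ be a root system on a Euclidean vector space $V$ (roots are linear functionals on $V$), $W$ its finite Weyl group, $\Delta\subset V$ the positive Weyl chamber, $R^+$ the positive roots, $\varpi_1,\dots,\varpi_l$ the fundamental coweights, $P(R^\vee)=\{\lambda\in V:\alpha(\lambda)\in\mathbb{Z}\ \forall\alpha\in R\}$, $\tau_\beta(v)=v-\beta(v)\beta^\vee$. $W_{aff}$ is generated by the reflections in the hyperplanes $\{\alpha=t\}$, $\alpha\in R,t\in\mathbb{Z}$, and $W_x$ is the stabilizer of $x$ in $W_{aff}$, identified with its linear part. Saturation factor $k_R$: if $R$ is irreducible with simple roots $\alpha_1,\dots,\alpha_l$ and highest root $\theta=\sum m_i\alpha_i$, then $k_R=\mathrm{lcm}(m_1,\dots,m_l)$; if $R$ is reducible, $k_R$ is the least common multiple of the saturation factors of the irreducible components. Chains: for a reflection subgroup $W'\subset W$, a $W'$-chain is a sequence $(\eta_0,\dots,\eta_m)$ of nonzero vectors with positive roots $\beta_i$ such that $\tau_{\beta_i}\in W'$, $\eta_i=\tau_{\beta_i}(\eta_{i-1})$, $\beta_i(\eta_{i-1})<0$ ($1\le i\le m$, $m\geq0$). Write $\nu\geq_{W'}\mu$ if there is a $W'$-chain from $\nu$ to $\mu$; $\nu>\mu$ means $\nu\geq_W\mu$ and $\nu\ne\mu$. Write $\mu\sim\nu$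 if $\mu,\nu$ lie in a common (closed) Weyl chamber of $W$, and $\nu\gtrsim_{W'}\mu$ if there is $\lambda$ with $\nu\geq_{W'}\lambda\sim\mu$. For $\nu\ge_W\mu$, $\mathrm{dist}(\nu,\mu)$ is the maximal length $m$ of a $W$-chain from $\nu$ to $\mu$. Paths are piecewise-linear, parametrized with constant speed, and considered up to orientation-preserving reparametrization. The $\Delta$-length $\mathrm{length}_\Delta$ of a path with successive vertices $x_0,\dots,x_n$ is $\sum_i d_\Delta(x_{i-1},x_i)$, where $d_\Delta(x,y)$ is the unique element of $\Delta$ in the $W$-orbit of $\overrightarrow{xy}$. For paths $p_1,p_2$ starting at $0$, the concatenation $p_1*p_2$ is $p_1$ followed by the translate of $p_2$ by $p_1(1)$. Generalized Hecke path: a path $p$ satisfying the chain condition (for each interior parameter $t$, $p'_-(t)\gtrsim_{W_{p(t)}}p'_+(t)$) and such that each geodesic segment of $p$, regarded as a vector, is an integer multiple of some $w\varpi_i$ with $w\in W$ and $\varpi_i$ a fundamental coweight. LS path of $\Delta$-length $\lambda\in\Delta\cap P(R^\vee)$: given rational numbers $0=a_0<a_1<\dots<a_r=1$ and vectors $\nu_1>\dots>\nu_r$ in $W\lambda$, the path $p(t)=\sum_{k=1}^{i-1}(a_k-a_{k-1})\nu_k+(t-a_{i-1})\nu_i$ for $t\in[a_{i-1},a_i]$, subject to the condition that for each $i=1,\dots,r-1$ there is an $a_i$-chain for $(\nu_i,\nu_{i+1})$. An $a$-chain for $(\nu,\mu)$ is a $W$-chain $(\lambda_0,\dots,\lambda_s)$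 from $\nu$ to $\mu$, with roots $\beta_j$, such that for each $j\geq1$: $\beta_j(a\lambda_{j-1})\in\mathbb{Z}$ and $\mathrm{dist}(\lambda_{j-1},\lambda_j)=1$. Generalized LS path: a concatenation $p=p_0*p_1*\dots*p_m$ where each $p_i$ is an LS path of $\Delta$-length $\lambda_i\in\Delta\cap P(R^\vee)$ and $p_i'(1)\gtrsim_W p_{i+1}'(0)$ for $i=0,\dots,m-1$; its $\Delta$-length is $\sum_i\lambda_i$. *)

theory Defs
  imports "HOL-Analysis.Analysis"
begin

section \<open>Root systems\<close>

text \<open>
  Roots are elements of the dual space of \<open>V = 'a\<close>, i.e. of type \<open>'a \<Rightarrow>\<^sub>L real\<close>.
  The Riesz vector of a root \<open>\<alpha>\<close> is \<open>adjoint \<alpha> 1\<close>, and the coroot is normalised by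
  \<open>\<alpha>(\<alpha>\<^sup>\<or>) = 2\<close>, so that \<open>\<tau>\<^sub>\<alpha>\<close> is the orthogonal reflection in the kernel of \<open>\<alpha>\<close>.
\<close>

definition coroot :: "('a::euclidean_space \<Rightarrow>\<^sub>L real) \<Rightarrow> 'a" where
  "coroot \<alpha> = (let a = adjoint (blinfun_apply \<alpha>) 1 in (2 / (a \<bullet> a)) *\<^sub>R a)"

definition reflection :: "('a::euclidean_space \<Rightarrow>\<^sub>L real) \<Rightarrow> 'a \<Rightarrow> 'a" where
  "reflection \<beta> v = v - blinfun_apply \<beta> v *\<^sub>R coroot \<beta>"

text \<open>Root systems are crystallographic and span the dual space; they need not be reduced.\<close>

definition root_system :: "('a::euclidean_space \<Rightarrow>\<^sub>L real) set \<Rightarrow> bool" where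
  "root_system R \<longleftrightarrow>
     finite R \<and> 0 \<notin> R \<and> span R = UNIV \<and>
     (\<forall>\<alpha>\<in>R. \<forall>\<beta>\<in>R. \<beta> - blinfun_apply \<beta> (coroot \<alpha>) *\<^sub>R \<alpha> \<in> R) \<and>
     (\<forall>\<alpha>\<in>R. \<forall>\<beta>\<in>R. blinfun_apply \<beta> (coroot \<alpha>) \<in> \<int>)"

text \<open>The closed Weyl chambers.\<close>

definition weyl_chambers :: "('a::euclidean_space \<Rightarrow>\<^sub>L real) set \<Rightarrow> 'a set set" where
  "weyl_chambers R = closure ` components (- (\<Union>\<alpha>\<in>R. {v. blinfun_apply \<alpha> v = 0}))"

definition pos_roots ::
  "('a::euclidean_space \<Rightarrow>\<^sub>L real) set \<Rightarrow> 'a set \<Rightarrow> ('a \<Rightarrow>\<^sub>L real) set" where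
  "pos_roots R \<Delta> = {\<alpha>\<in>R. \<forall>v\<in>\<Delta>. blinfun_apply \<alpha> v \<ge> 0}"

definition simple_roots ::
  "('a::euclidean_space \<Rightarrow>\<^sub>L real) set \<Rightarrow> 'a set \<Rightarrow> ('a \<Rightarrow>\<^sub>L real) set" where
  "simple_roots R \<Delta> =
     {\<alpha> \<in> pos_roots R \<Delta>. \<not> (\<exists>\<beta>\<in>pos_roots R \<Delta>. \<exists>\<gamma>\<in>pos_roots R \<Delta>. \<alpha> = \<beta> + \<gamma>)}"

text \<open>The fundamental coweights form the basis of \<open>V\<close> dual to the simple roots.\<close>

definition fundamental_coweights ::
  "('a::euclidean_space \<Rightarrow>\<^sub>L real) set \<Rightarrow> 'a set \<Rightarrow> 'a set" where
  "fundamental_coweights R \<Delta> =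
     {w. \<exists>\<alpha>\<in>simple_roots R \<Delta>. blinfun_apply \<alpha> w = 1 \<and>
           (\<forall>\<beta>\<in>simple_roots R \<Delta> - {\<alpha>}. blinfun_apply \<beta> w = 0)}"

definition coweight_lattice :: "('a::euclidean_space \<Rightarrow>\<^sub>L real) set \<Rightarrow> 'a set" where
  "coweight_lattice R = {v. \<forall>\<alpha>\<in>R. blinfun_apply \<alpha> v \<in> \<int>}"


section \<open>Weyl groups\<close>

text \<open>
  The group generated by a set of involutions; as the generators are their own inverses,
  closure under composition suffices.
\<close>

inductive_set generated_group :: "('a \<Rightarrow> 'a) set \<Rightarrow> ('a \<Rightarrow> 'a) set"
  for S :: "('a \<Rightarrow> 'a) set" where
  id: "id \<in> generated_group S"
| step: "\<lbrakk>s \<in> S; w \<in> generated_group S\<rbrakk> \<Longrightarrow> s \<circ> w \<in> generated_group S"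

definition weyl_group :: "('a::euclidean_space \<Rightarrow>\<^sub>L real) set \<Rightarrow> ('a \<Rightarrow> 'a) set" where
  "weyl_group R = generated_group (reflection ` R)"

definition affine_reflection :: "('a::euclidean_space \<Rightarrow>\<^sub>L real) \<Rightarrow> real \<Rightarrow> 'a \<Rightarrow> 'a" where
  "affine_reflection \<alpha> t v = v - (blinfun_apply \<alpha> v - t) *\<^sub>R coroot \<alpha>"

definition affine_weyl_group :: "('a::euclidean_space \<Rightarrow>\<^sub>L real) set \<Rightarrow> ('a \<Rightarrow> 'a) set" where
  "affine_weyl_group R = generated_group {affine_reflection \<alpha> t | \<alpha> t. \<alpha> \<in> R \<and> t \<in> \<int>}"

text \<open>The group of linear parts \<open>v \<mapsto> g v - g 0\<close> of the elements \<open>g\<close> of \<open>W\<^sub>a\<^sub>f\<^sub>f\<close> fixing \<open>x\<close>.\<close>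

definition stabilizer :: "('a::euclidean_space \<Rightarrow>\<^sub>L real) set \<Rightarrow> 'a \<Rightarrow> ('a \<Rightarrow> 'a) set" where
  "stabilizer R x = {(\<lambda>v. g v - g 0) | g. g \<in> affine_weyl_group R \<and> g x = x}"

definition weyl_orbit :: "('a::euclidean_space \<Rightarrow>\<^sub>L real) set \<Rightarrow> 'a \<Rightarrow> 'a set" where
  "weyl_orbit R v = (\<lambda>w. w v) ` weyl_group R"

definition delta_dist ::
  "('a::euclidean_space \<Rightarrow>\<^sub>L real) set \<Rightarrow> 'a set \<Rightarrow> 'a \<Rightarrow> 'a \<Rightarrow> 'a" where
  "delta_dist R \<Delta> x y = (THE v. v \<in> \<Delta> \<and> v \<in> weyl_orbit R (y - x))"


section \<open>The saturation factor\<close>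

definition orthogonal_roots ::
  "('a::euclidean_space \<Rightarrow>\<^sub>L real) set \<Rightarrow> ('a \<Rightarrow>\<^sub>L real) set \<Rightarrow> bool" where
  "orthogonal_roots A B \<longleftrightarrow> (\<forall>\<alpha>\<in>A. \<forall>\<beta>\<in>B. blinfun_apply \<alpha> (coroot \<beta>) = 0)"

definition irreducible_roots :: "('a::euclidean_space \<Rightarrow>\<^sub>L real) set \<Rightarrow> bool" where
  "irreducible_roots R \<longleftrightarrow> R \<noteq> {} \<and>
     \<not> (\<exists>A B. A \<noteq> {} \<and> B \<noteq> {} \<and> A \<inter> B = {} \<and> A \<union> B = R \<and> orthogonal_roots A B)"

definition irreducible_components ::
  "('a::euclidean_space \<Rightarrow>\<^sub>L real) set \<Rightarrow> ('a \<Rightarrow>\<^sub>L real) set set" where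
  "irreducible_components R = {C. C \<subseteq> R \<and> irreducible_roots C \<and> orthogonal_roots C (R - C)}"

definition highest_root ::
  "('a::euclidean_space \<Rightarrow>\<^sub>L real) set \<Rightarrow> 'a set \<Rightarrow> ('a \<Rightarrow>\<^sub>L real)" where
  "highest_root C \<Delta> = (THE \<theta>. \<theta> \<in> C \<and>
     (\<forall>\<beta>\<in>C. \<exists>c :: ('a \<Rightarrow>\<^sub>L real) \<Rightarrow> nat.
        \<theta> - \<beta> = (\<Sum>\<alpha>\<in>simple_roots C \<Delta>. real (c \<alpha>) *\<^sub>R \<alpha>)))"

text \<open>
  For an irreducible component \<open>C\<close> of \<open>R\<close>, the roots of \<open>C\<close> that are non-negative on the chamber
  \<open>\<Delta>\<close> of \<open>R\<close> form a positive system of \<open>C\<close>, so \<open>\<Delta>\<close> can serve for \<open>C\<close> as well. The numbers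
  \<open>m\<close> below are the coefficients of the highest root with respect to the simple roots.
\<close>

definition irreducible_saturation_factor ::
  "('a::euclidean_space \<Rightarrow>\<^sub>L real) set \<Rightarrow> 'a set \<Rightarrow> nat" where
  "irreducible_saturation_factor C \<Delta> =
     Lcm {m. \<exists>\<alpha>\<in>simple_roots C \<Delta>.
             real m = representation (simple_roots C \<Delta>) (highest_root C \<Delta>) \<alpha>}"

text \<open>If \<open>R\<close> is irreducible, its only irreducible component is \<open>R\<close>. The value does not depend
  on the chamber \<open>\<Delta>\<close>.\<close>

definition saturation_factor ::
  "('a::euclidean_space \<Rightarrow>\<^sub>L real) set \<Rightarrow> 'a set \<Rightarrow> nat" where
  "saturation_factor R \<Delta> =
     Lcm ((\<lambda>C. irreducible_saturation_factor C \<Delta>) ` irreducible_components R)"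


section \<open>Chains\<close>

text \<open>\<open>W'\<close>-chains \<open>(\<eta> 0, \<dots>, \<eta> m)\<close> with roots \<open>\<beta> 1, \<dots>, \<beta> m\<close>.\<close>

definition is_chain ::
  "('a::euclidean_space \<Rightarrow>\<^sub>L real) set \<Rightarrow> 'a set \<Rightarrow> ('a \<Rightarrow> 'a) set \<Rightarrow>
     nat \<Rightarrow> (nat \<Rightarrow> 'a) \<Rightarrow> (nat \<Rightarrow> ('a \<Rightarrow>\<^sub>L real)) \<Rightarrow> bool" where
  "is_chain R \<Delta> W' m \<eta> \<beta> \<longleftrightarrow>
     (\<forall>i\<le>m. \<eta> i \<noteq> 0) \<and>
     (\<forall>i\<in>{1..m}. \<beta> i \<in> pos_roots R \<Delta> \<and> reflection (\<beta> i) \<in> W' \<and>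
        \<eta> i = reflection (\<beta> i) (\<eta> (i - 1)) \<and> blinfun_apply (\<beta> i) (\<eta> (i - 1)) < 0)"

definition chain_ge ::
  "('a::euclidean_space \<Rightarrow>\<^sub>L real) set \<Rightarrow> 'a set \<Rightarrow> ('a \<Rightarrow> 'a) set \<Rightarrow> 'a \<Rightarrow> 'a \<Rightarrow> bool" where
  "chain_ge R \<Delta> W' \<nu> \<mu> \<longleftrightarrow> (\<exists>m \<eta> \<beta>. is_chain R \<Delta> W' m \<eta> \<beta> \<and> \<eta> 0 = \<nu> \<and> \<eta> m = \<mu>)"

definition chain_gt ::
  "('a::euclidean_space \<Rightarrow>\<^sub>L real) set \<Rightarrow> 'a set \<Rightarrow> 'a \<Rightarrow> 'a \<Rightarrow> bool" where
  "chain_gt R \<Delta> \<nu> \<mu> \<longleftrightarrow> chain_ge R \<Delta> (weyl_group R) \<nu> \<mu> \<and> \<nu> \<noteq> \<mu>"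

definition same_chamber :: "('a::euclidean_space \<Rightarrow>\<^sub>L real) set \<Rightarrow> 'a \<Rightarrow> 'a \<Rightarrow> bool" where
  "same_chamber R \<mu> \<nu> \<longleftrightarrow> (\<exists>C\<in>weyl_chambers R. \<mu> \<in> C \<and> \<nu> \<in> C)"

definition chain_gtrsim ::
  "('a::euclidean_space \<Rightarrow>\<^sub>L real) set \<Rightarrow> 'a set \<Rightarrow> ('a \<Rightarrow> 'a) set \<Rightarrow> 'a \<Rightarrow> 'a \<Rightarrow> bool" where
  "chain_gtrsim R \<Delta> W' \<nu> \<mu> \<longleftrightarrow> (\<exists>l. chain_ge R \<Delta> W' \<nu> l \<and> same_chamber R l \<mu>)"

text \<open>Meaningful only if \<open>\<nu> \<ge> \<mu>\<close>; the set is then finite and nonempty.\<close>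

definition chain_dist ::
  "('a::euclidean_space \<Rightarrow>\<^sub>L real) set \<Rightarrow> 'a set \<Rightarrow> 'a \<Rightarrow> 'a \<Rightarrow> nat" where
  "chain_dist R \<Delta> \<nu> \<mu> =
     Max {m. \<exists>\<eta> \<beta>. is_chain R \<Delta> (weyl_group R) m \<eta> \<beta> \<and> \<eta> 0 = \<nu> \<and> \<eta> m = \<mu>}"

definition has_a_chain ::
  "('a::euclidean_space \<Rightarrow>\<^sub>L real) set \<Rightarrow> 'a set \<Rightarrow> real \<Rightarrow> 'a \<Rightarrow> 'a \<Rightarrow> bool" where
  "has_a_chain R \<Delta> a \<nu> \<mu> \<longleftrightarrow>
     (\<exists>s l \<beta>. is_chain R \<Delta> (weyl_group R) s l \<beta> \<and> l 0 = \<nu> \<and> l s = \<mu> \<and>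
        (\<forall>j\<in>{1..s}. blinfun_apply (\<beta> j) (a *\<^sub>R l (j - 1)) \<in> \<int> \<and>
                    chain_dist R \<Delta> (l (j - 1)) (l j) = 1))"


section \<open>Paths\<close>

text \<open>
  Paths are functions on \<open>{0..1}\<close>; their values elsewhere are irrelevant. A piecewise-linear
  path parametrized with constant speed \<open>c\<close>:
\<close>

definition pl_path :: "(real \<Rightarrow> 'a::euclidean_space) \<Rightarrow> bool" where
  "pl_path p \<longleftrightarrow>
     (\<exists>n t u c. n \<ge> 1 \<and> t 0 = 0 \<and> t n = 1 \<and>
        (\<forall>i<n. t i < t (Suc i) \<and> norm (u i) = c \<and>
           (\<forall>s\<in>{t i..t (Suc i)}. p s = p (t i) + (s - t i) *\<^sub>R u i)))"

text \<open>
  The vertices of a piecewise-linear constant-speed path are its endpoints and the points at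
  which it fails to be differentiable. They cut the path into its (maximal) geodesic segments,
  which are recorded here as vectors \<open>(x\<^sub>i\<^sub>-\<^sub>1, x\<^sub>i)\<close> of successive vertices.
\<close>

definition vertex_times :: "(real \<Rightarrow> 'a::euclidean_space) \<Rightarrow> real list" where
  "vertex_times p =
     sorted_list_of_set ({0, 1} \<union> {t\<in>{0<..<1}. \<not> p differentiable (at t)})"

definition geodesic_segments :: "(real \<Rightarrow> 'a::euclidean_space) \<Rightarrow> ('a \<times> 'a) list" where
  "geodesic_segments p = (let xs = map p (vertex_times p) in zip xs (tl xs))"

definition delta_length ::
  "('a::euclidean_space \<Rightarrow>\<^sub>L real) set \<Rightarrow> 'a set \<Rightarrow> (real \<Rightarrow> 'a) \<Rightarrow> 'a" where
  "delta_length R \<Delta> p = (\<Sum>(x, y) \<leftarrow> geodesic_segments p. delta_dist R \<Delta> x y)"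

definition left_velocity :: "(real \<Rightarrow> 'a::euclidean_space) \<Rightarrow> real \<Rightarrow> 'a" where
  "left_velocity p t = vector_derivative p (at_left t)"

definition right_velocity :: "(real \<Rightarrow> 'a::euclidean_space) \<Rightarrow> real \<Rightarrow> 'a" where
  "right_velocity p t = vector_derivative p (at_right t)"

definition chain_condition ::
  "('a::euclidean_space \<Rightarrow>\<^sub>L real) set \<Rightarrow> 'a set \<Rightarrow> (real \<Rightarrow> 'a) \<Rightarrow> bool" where
  "chain_condition R \<Delta> p \<longleftrightarrow>
     (\<forall>t\<in>{0<..<1}.
        chain_gtrsim R \<Delta> (stabilizer R (p t)) (left_velocity p t) (right_velocity p t))"

definition generalized_hecke_path ::
  "('a::euclidean_space \<Rightarrow>\<^sub>L real) set \<Rightarrow> 'a set \<Rightarrow> (real \<Rightarrow> 'a) \<Rightarrow> bool" where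
  "generalized_hecke_path R \<Delta> p \<longleftrightarrow>
     pl_path p \<and> chain_condition R \<Delta> p \<and>
     (\<forall>(x, y)\<in>set (geodesic_segments p).
        \<exists>k::int. \<exists>w\<in>weyl_group R. \<exists>v\<in>fundamental_coweights R \<Delta>. y - x = of_int k *\<^sub>R w v)"

definition ls_path ::
  "('a::euclidean_space \<Rightarrow>\<^sub>L real) set \<Rightarrow> 'a set \<Rightarrow> 'a \<Rightarrow> (real \<Rightarrow> 'a) \<Rightarrow> bool" where
  "ls_path R \<Delta> l p \<longleftrightarrow>
     l \<in> \<Delta> \<inter> coweight_lattice R \<and>
     (\<exists>r a \<nu>. r \<ge> 1 \<and> a 0 = 0 \<and> a r = 1 \<and> (\<forall>i\<le>r. a i \<in> \<rat>) \<and> (\<forall>i<r. a i < a (Suc i)) \<and>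
        (\<forall>i\<in>{1..r}. \<nu> i \<in> weyl_orbit R l) \<and>
        (\<forall>i\<in>{1..<r}. chain_gt R \<Delta> (\<nu> i) (\<nu> (Suc i))) \<and>
        (\<forall>i\<in>{1..<r}. has_a_chain R \<Delta> (a i) (\<nu> i) (\<nu> (Suc i))) \<and>
        (\<forall>i\<in>{1..r}. \<forall>t\<in>{a (i - 1)..a i}.
           p t = (\<Sum>k\<in>{1..<i}. (a k - a (k - 1)) *\<^sub>R \<nu> k) + (t - a (i - 1)) *\<^sub>R \<nu> i))"

text \<open>The concatenation \<open>p\<^sub>1 * p\<^sub>2\<close> of paths starting at \<open>0\<close>, and its iteration.\<close>

definition path_concat ::
  "(real \<Rightarrow> 'a::euclidean_space) \<Rightarrow> (real \<Rightarrow> 'a) \<Rightarrow> (real \<Rightarrow> 'a)" where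
  "path_concat p q = p +++ (\<lambda>t. pathfinish p + q t)"

fun path_concat_list :: "(real \<Rightarrow> 'a::euclidean_space) list \<Rightarrow> (real \<Rightarrow> 'a)" where
  "path_concat_list [] = (\<lambda>t. 0)"
| "path_concat_list [p] = p"
| "path_concat_list (p # q # ps) = path_concat p (path_concat_list (q # ps))"

text \<open>\<open>q\<close> is an orientation-preserving reparametrization of \<open>p\<close>.\<close>

definition reparametrization ::
  "(real \<Rightarrow> 'a::euclidean_space) \<Rightarrow> (real \<Rightarrow> 'a) \<Rightarrow> bool" where
  "reparametrization p q \<longleftrightarrow>
     (\<exists>\<phi> :: real \<Rightarrow> real. continuous_on {0..1} \<phi> \<and> strict_mono_on {0..1} \<phi> \<and>
        \<phi> 0 = 0 \<and> \<phi> 1 = 1 \<and> (\<forall>t\<in>{0..1}. q t = p (\<phi> t)))"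

text \<open>\<open>p\<close> is, up to reparametrization, a generalized LS path of \<open>\<Delta>\<close>-length \<open>L\<close>.\<close>

definition generalized_ls_path ::
  "('a::euclidean_space \<Rightarrow>\<^sub>L real) set \<Rightarrow> 'a set \<Rightarrow> 'a \<Rightarrow> (real \<Rightarrow> 'a) \<Rightarrow> bool" where
  "generalized_ls_path R \<Delta> L p \<longleftrightarrow>
     (\<exists>ps ls. ps \<noteq> [] \<and> length ls = length ps \<and>
        (\<forall>i<length ps. ls_path R \<Delta> (ls ! i) (ps ! i)) \<and>
        (\<forall>i. Suc i < length ps \<longrightarrow>
           chain_gtrsim R \<Delta> (weyl_group R)
             (left_velocity (ps ! i) 1) (right_velocity (ps ! Suc i) 0)) \<and>
        reparametrization (path_concat_list ps) p \<and>
        L = sum_list ls)"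


section \<open>Basic facts on reflections\<close>

lemma blinfun_apply_eq_inner_adjoint:
  fixes \<alpha> :: "'a::euclidean_space \<Rightarrow>\<^sub>L real"
  shows "blinfun_apply \<alpha> v = v \<bullet> adjoint (blinfun_apply \<alpha>) 1"
  using adjoint_works[of "blinfun_apply \<alpha>" v 1]
  by (simp add: bounded_linear.linear[OF blinfun.bounded_linear_right])

lemma root_coroot:
  fixes \<alpha> :: "'a::euclidean_space \<Rightarrow>\<^sub>L real"
  assumes "\<alpha> \<noteq> 0"
  shows "blinfun_apply \<alpha> (coroot \<alpha>) = 2"
proof -
  define a where "a = adjoint (blinfun_apply \<alpha>) 1"
  have eq: "blinfun_apply \<alpha> v = v \<bullet> a" for v
    unfolding a_def by (rule blinfun_apply_eq_inner_adjoint)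
  have "a \<noteq> 0"
    using assms eq by (metis blinfun_eqI inner_zero_right zero_blinfun.rep_eq)
  then show ?thesis
    by (simp add: eq coroot_def Let_def flip: a_def)
qed

end

theory Submission
  imports Defs
begin

text \<open>
  Every geodesic segment of a generalized Hecke path is an integer multiple of a vector in the
  \<open>W\<close>-orbit of a fundamental coweight. Such vectors lie in \<open>P(R\<^sup>\<or>)\<close>: a positive root is a sum of
  simple roots, so it is integral on the fundamental coweights, and \<open>W\<close> permutes the roots. Hence,
  after dilation by a natural number \<open>k\<close>, a segment from \<open>x\<close> to \<open>y\<close> is by itself an LS path, namely
  a straight one (\<open>r = 1\<close>), of \<open>\<Delta>\<close>-length \<open>k d\<^sub>\<Delta>(x, y)\<close>. The dilated path is, up to
  reparametrization, the concatenation of these straight paths, and their \<open>\<Delta>\<close>-lengths add up to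
  \<open>k length\<^sub>\<Delta>(p)\<close>. The condition at a junction of two segments comes from the chain condition at
  that vertex of \<open>p\<close>. The roots of a chain for \<open>W\<^sub>x\<close> are roots of \<open>R\<close>, so it is a chain for \<open>W\<close>;
  and chains and closed chambers are stable under positive rescaling, which absorbs both the
  dilation and the passage from velocities to segment vectors. For \<open>k = 0\<close> chains do not exist, as
  they consist of nonzero vectors, and the constant path is a single LS path instead.

  Two facts support this. First, \<open>d\<^sub>\<Delta>\<close> is well defined: every \<open>W\<close>-orbit meets \<open>\<Delta>\<close> in exactly one
  point (\<open>ex1_dominant_in_weyl_orbit\<close>). A representative in \<open>\<Delta>\<close> is found by maximizing the inner
  product with a vector inside \<open>\<Delta>\<close>; uniqueness is a deletion argument for words in the reflections
  in the walls of \<open>\<Delta>\<close> (\<open>word_deletion\<close>, \<open>word_dominant_eq\<close>), together with the fact that these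
  reflections generate \<open>W\<close> (\<open>weyl_group_eq_word\<close>). Second, a piecewise-linear path is affine
  between successive points of non-differentiability (\<open>affine_piece_vertex_times\<close>), and a polygon is
  a reparametrized concatenation of its sides (\<open>polygon_eq_path_concat_list\<close>).
\<close>

section \<open>Reflections\<close>

definition riesz :: "('a::euclidean_space \<Rightarrow>\<^sub>L real) \<Rightarrow> 'a" where
  "riesz \<alpha> = adjoint (blinfun_apply \<alpha>) 1"

lemma apply_eq_inner_riesz: "blinfun_apply \<alpha> v = v \<bullet> riesz \<alpha>"
  unfolding riesz_def by (rule blinfun_apply_eq_inner_adjoint)

lemma riesz_unique:
  assumes "\<And>v. blinfun_apply \<alpha> v = v \<bullet> a"
  shows "riesz \<alpha> = a"
proof -
  have "\<forall>v. v \<bullet> riesz \<alpha> = v \<bullet> a" using assms apply_eq_inner_riesz by metis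
  then show ?thesis by (simp only: vector_eq_ldot)
qed

lemma riesz_scaleR: "riesz (c *\<^sub>R \<alpha>) = c *\<^sub>R riesz \<alpha>"
  by (rule riesz_unique) (simp add: scaleR_blinfun.rep_eq apply_eq_inner_riesz)

lemma riesz_eq_0_iff [simp]: "riesz \<alpha> = 0 \<longleftrightarrow> \<alpha> = 0"
proof
  assume "riesz \<alpha> = 0"
  then show "\<alpha> = 0" by (intro blinfun_eqI) (simp add: apply_eq_inner_riesz[of \<alpha>])
qed (simp add: riesz_unique)

lemma riesz_0 [simp]: "riesz 0 = 0"
  by simp

lemma coroot_eq_riesz: "coroot \<alpha> = (2 / (riesz \<alpha> \<bullet> riesz \<alpha>)) *\<^sub>R riesz \<alpha>"
  by (simp add: coroot_def riesz_def Let_def)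

lemma inner_coroot: "v \<bullet> coroot \<alpha> = 2 * blinfun_apply \<alpha> v / (riesz \<alpha> \<bullet> riesz \<alpha>)"
  by (simp add: coroot_eq_riesz apply_eq_inner_riesz)

lemma inner_coroot_pos:
  assumes "blinfun_apply \<alpha> v > 0"
  shows "v \<bullet> coroot \<alpha> > 0"
proof -
  have "riesz \<alpha> \<noteq> 0" using assms by auto
  then show ?thesis using assms by (simp add: inner_coroot)
qed

lemma apply_coroot_pos_sym:
  assumes "blinfun_apply \<alpha> (coroot \<beta>) > 0"
  shows "blinfun_apply \<beta> (coroot \<alpha>) > 0"
proof -
  have nz: "\<alpha> \<noteq> 0" "\<beta> \<noteq> 0" using assms by (auto simp: coroot_eq_riesz)
  have "blinfun_apply \<alpha> (coroot \<beta>) * (riesz \<beta> \<bullet> riesz \<beta>) > 0"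
    using assms nz by simp
  then have "riesz \<beta> \<bullet> riesz \<alpha> > 0"
    using nz by (simp add: apply_eq_inner_riesz coroot_eq_riesz)
  then show ?thesis
    using nz by (simp add: apply_eq_inner_riesz coroot_eq_riesz inner_commute)
qed

lemma reflection_scaleR: "reflection (c *\<^sub>R \<alpha>) = reflection \<alpha>" if "c \<noteq> 0"
  using that by (auto simp: fun_eq_iff reflection_def coroot_eq_riesz riesz_scaleR scaleR_blinfun.rep_eq)

lemma linear_reflection: "linear (reflection \<alpha>)"
  by (rule linearI) (auto simp: reflection_def blinfun.add_right blinfun.scaleR_right algebra_simps)

lemma reflection_reflection [simp]: "reflection \<alpha> (reflection \<alpha> v) = v" if "\<alpha> \<noteq> 0"
  by (simp add: reflection_def blinfun.diff_right blinfun.scaleR_right root_coroot[OF that])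

lemma inner_reflection_left: "reflection \<alpha> v \<bullet> w = v \<bullet> reflection \<alpha> w"
  by (simp add: reflection_def inner_diff coroot_eq_riesz apply_eq_inner_riesz inner_commute)

definition reflect_root ::
  "('a::euclidean_space \<Rightarrow>\<^sub>L real) \<Rightarrow> ('a \<Rightarrow>\<^sub>L real) \<Rightarrow> ('a \<Rightarrow>\<^sub>L real)" where
  "reflect_root \<alpha> \<beta> = \<beta> - blinfun_apply \<beta> (coroot \<alpha>) *\<^sub>R \<alpha>"

lemma apply_reflect_root: "blinfun_apply (reflect_root \<alpha> \<beta>) v = blinfun_apply \<beta> (reflection \<alpha> v)"
  by (simp add: reflect_root_def reflection_def blinfun.diff_left blinfun.diff_right
      blinfun.scaleR_left blinfun.scaleR_right)

lemma riesz_reflect_root: "riesz (reflect_root \<alpha> \<beta>) = reflection \<alpha> (riesz \<beta>)"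
  by (rule riesz_unique) (simp add: apply_reflect_root apply_eq_inner_riesz[of \<beta>] inner_reflection_left)

text \<open>
  Reflections are orthogonal, so conjugating \<open>\<tau>\<^sub>\<beta>\<close> by \<open>\<tau>\<^sub>\<alpha>\<close> gives the reflection in the root
  \<open>\<beta> \<circ> \<tau>\<^sub>\<alpha>\<close>.
\<close>

lemma reflection_reflect_root:
  assumes "\<alpha> \<noteq> 0"
  shows "reflection (reflect_root \<alpha> \<beta>) (reflection \<alpha> v) = reflection \<alpha> (reflection \<beta> v)"
proof -
  have "coroot (reflect_root \<alpha> \<beta>) = reflection \<alpha> (coroot \<beta>)"
    using assms by (simp add: coroot_eq_riesz riesz_reflect_root inner_reflection_left
        linear_cmul[OF linear_reflection])
  then show ?thesis
    using assms by (simp add: reflection_def[of "reflect_root \<alpha> \<beta>"] apply_reflect_root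
        reflection_def[of \<beta>] linear_diff[OF linear_reflection] linear_cmul[OF linear_reflection])
qed


section \<open>Dominant representatives\<close>

text \<open>
  A vector \<open>\<rho>\<close> on no root hyperplane selects a chamber. Describing the chamber by the signs of the
  roots at \<open>\<rho>\<close> replaces the topology in the definition of Weyl chambers by inequalities.
\<close>

locale regular_vector =
  fixes R :: "('a::euclidean_space \<Rightarrow>\<^sub>L real) set" and \<rho> :: 'a
  assumes root_system: "root_system R"
    and regular: "\<alpha> \<in> R \<Longrightarrow> blinfun_apply \<alpha> \<rho> \<noteq> 0"
begin

definition Pos :: "('a \<Rightarrow>\<^sub>L real) set" where
  "Pos = {\<alpha>\<in>R. blinfun_apply \<alpha> \<rho> > 0}"

definition dominant :: "'a \<Rightarrow> bool" where
  "dominant v \<longleftrightarrow> (\<forall>\<alpha>\<in>Pos. blinfun_apply \<alpha> v \<ge> 0)"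

text \<open>
  The hyperplane of a wall root carries a facet of the chamber of \<open>\<rho>\<close>, and \<open>y\<close> is a point in the
  relative interior of that facet. The root is determined only up to a positive factor, because
  \<open>R\<close> may contain proportional roots.
\<close>

definition wall :: "('a \<Rightarrow>\<^sub>L real) \<Rightarrow> bool" where
  "wall \<alpha> \<longleftrightarrow> \<alpha> \<in> Pos \<and> (\<exists>y. blinfun_apply \<alpha> y = 0 \<and>
     (\<forall>\<beta>\<in>Pos. (\<nexists>c. \<beta> = c *\<^sub>R \<alpha>) \<longrightarrow> blinfun_apply \<beta> y > 0))"

lemma finite_R: "finite R" and root_nonzero: "\<alpha> \<in> R \<Longrightarrow> \<alpha> \<noteq> 0"
  using root_system by (auto simp: root_system_def)

lemma reflect_root_in: "\<alpha> \<in> R \<Longrightarrow> \<beta> \<in> R \<Longrightarrow> reflect_root \<alpha> \<beta> \<in> R"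
  using root_system by (simp add: root_system_def reflect_root_def)

lemma uminus_root_in:
  assumes "\<alpha> \<in> R" shows "- \<alpha> \<in> R"
proof -
  have "reflect_root \<alpha> \<alpha> = - \<alpha>"
    using root_coroot[OF root_nonzero[OF assms]] by (simp add: reflect_root_def scaleR_2)
  then show ?thesis using reflect_root_in[OF assms assms] by simp
qed

lemma Pos_subset: "Pos \<subseteq> R" and finite_Pos: "finite Pos"
  using finite_R by (auto simp: Pos_def)

lemma root_cases:
  assumes "\<alpha> \<in> R" obtains "\<alpha> \<in> Pos" | "- \<alpha> \<in> Pos"
  using assms regular[OF assms] uminus_root_in[OF assms]
  by (force simp: Pos_def blinfun.minus_left)

text \<open>
  The height \<open>\<alpha> \<mapsto> \<alpha>(\<rho>)\<close> takes only finitely many values on the positive roots, which allows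
  induction although these values are real.
\<close>

lemma Pos_induct [consumes 1, case_names less]:
  assumes "\<alpha> \<in> Pos"
    and "\<And>\<alpha>. \<alpha> \<in> Pos \<Longrightarrow> (\<And>\<beta>. \<beta> \<in> Pos \<Longrightarrow> blinfun_apply \<beta> \<rho> < blinfun_apply \<alpha> \<rho> \<Longrightarrow> P \<beta>) \<Longrightarrow> P \<alpha>"
  shows "P \<alpha>"
  using assms(1)
proof (induction "card {\<beta>\<in>Pos. blinfun_apply \<beta> \<rho> < blinfun_apply \<alpha> \<rho>}" arbitrary: \<alpha> rule: less_induct)
  case less
  show ?case
  proof (rule assms(2)[OF less.prems])
    fix \<beta> assume \<beta>: "\<beta> \<in> Pos" "blinfun_apply \<beta> \<rho> < blinfun_apply \<alpha> \<rho>"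
    have "{\<gamma>\<in>Pos. blinfun_apply \<gamma> \<rho> < blinfun_apply \<beta> \<rho>}
        \<subset> {\<gamma>\<in>Pos. blinfun_apply \<gamma> \<rho> < blinfun_apply \<alpha> \<rho>}"
      using \<beta> by force
    then show "P \<beta>"
      using less.hyps \<beta>(1) finite_Pos by (simp add: psubset_card_mono)
  qed
qed

text \<open>
  The reflection in a wall fixes an inner point of the facet. At that point a positive root that is
  not proportional to the wall root is positive, and so is its image.
\<close>

lemma reflect_root_wall_Pos:
  assumes "wall \<alpha>" "\<beta> \<in> Pos" "\<nexists>c. \<beta> = c *\<^sub>R \<alpha>"
  shows "reflect_root \<alpha> \<beta> \<in> Pos"
proof (rule ccontr)
  assume np: "reflect_root \<alpha> \<beta> \<notin> Pos"
  obtain y where y: "blinfun_apply \<alpha> y = 0"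
    "\<And>\<beta>. \<beta> \<in> Pos \<Longrightarrow> (\<nexists>c. \<beta> = c *\<^sub>R \<alpha>) \<Longrightarrow> blinfun_apply \<beta> y > 0"
    using assms(1) by (auto simp: wall_def)
  have nonneg: "blinfun_apply \<gamma> y \<ge> 0" if "\<gamma> \<in> Pos" for \<gamma>
    using y that by (cases "\<exists>c. \<gamma> = c *\<^sub>R \<alpha>") (auto simp: scaleR_blinfun.rep_eq less_imp_le)
  have "reflect_root \<alpha> \<beta> \<in> R"
    using assms Pos_subset by (auto simp: wall_def intro: reflect_root_in)
  then have "- reflect_root \<alpha> \<beta> \<in> Pos" using np root_cases by blast
  then have "blinfun_apply (- reflect_root \<alpha> \<beta>) y \<ge> 0" by (rule nonneg)
  moreover have "reflection \<alpha> y = y" using y(1) by (simp add: reflection_def)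
  ultimately have "blinfun_apply \<beta> y \<le> 0"
    by (simp add: blinfun.minus_left apply_reflect_root)
  then show False using y(2)[OF assms(2,3)] by simp
qed

text \<open>
  An open set is not covered by finitely many hyperplanes.
\<close>

lemma exists_generic_positive_vector:
  fixes F :: "('a \<Rightarrow>\<^sub>L real) set"
  assumes "finite F" "0 \<notin> F"
  obtains z where "\<And>\<alpha>. \<alpha> \<in> Pos \<Longrightarrow> blinfun_apply \<alpha> z > 0" "\<And>f. f \<in> F \<Longrightarrow> blinfun_apply f z \<noteq> 0"
proof -
  define C where "C = (\<Inter>\<alpha>\<in>Pos. {v. blinfun_apply \<alpha> v > 0})"
  have "open C" unfolding C_def
    by (intro open_INT finite_Pos ballI open_Collect_less continuous_intros)
  moreover have "\<rho> \<in> C" by (auto simp: C_def Pos_def)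
  ultimately have "\<not> negligible C" using open_not_negligible by blast
  moreover have "negligible (\<Union>f\<in>F. {v. blinfun_apply f v = 0})"
  proof (intro negligible_Union ballI)
    fix t assume "t \<in> (\<lambda>f. {v. blinfun_apply f v = 0}) ` F"
    then obtain f where f: "f \<in> F" "t = {v. blinfun_apply f v = 0}" by auto
    have "negligible {v. riesz f \<bullet> v = 0}"
      using f assms(2) by (intro negligible_hyperplane) auto
    then show "negligible t" using f by (simp add: apply_eq_inner_riesz inner_commute)
  qed (use assms in auto)
  ultimately have "\<not> C \<subseteq> (\<Union>f\<in>F. {v. blinfun_apply f v = 0})"
    using negligible_subset by blast
  then show ?thesis using that by (auto simp: C_def)
qed

text \<open>
  Moving from \<open>x\<close> in a direction \<open>z\<close> inside the chamber, one enters the closed chamber at a point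
  \<open>y = x + q z\<close>. If \<open>z\<close> is generic, only one root hyperplane is crossed at that moment; it is a wall,
  and \<open>x\<close> lies on its negative side.
\<close>

lemma exists_separating_wall:
  assumes "\<gamma> \<in> Pos" "blinfun_apply \<gamma> x < 0"
  obtains \<alpha> where "wall \<alpha>" "blinfun_apply \<alpha> x < 0"
proof -
  \<comment> \<open>If \<open>x + q z\<close> lies on the hyperplanes of both \<open>\<alpha>\<close> and \<open>\<beta>\<close>, then \<open>\<beta>(x) \<alpha> - \<alpha>(x) \<beta>\<close> vanishes
    at \<open>z\<close>; a generic \<open>z\<close> excludes this unless the functional is zero.\<close>
  define F where "F = (\<lambda>(\<alpha>, \<beta>). blinfun_apply \<beta> x *\<^sub>R \<alpha> - blinfun_apply \<alpha> x *\<^sub>R \<beta>) ` (Pos \<times> Pos) - {0}"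
  have "finite F" "0 \<notin> F" using finite_Pos by (auto simp: F_def)
  then obtain z where z: "\<And>\<alpha>. \<alpha> \<in> Pos \<Longrightarrow> blinfun_apply \<alpha> z > 0"
    "\<And>f. f \<in> F \<Longrightarrow> blinfun_apply f z \<noteq> 0"
    using exists_generic_positive_vector by blast
  \<comment> \<open>the moment at which the last root becomes nonnegative\<close>
  define q where "q = Max ((\<lambda>\<alpha>. - blinfun_apply \<alpha> x / blinfun_apply \<alpha> z) ` Pos)"
  have le: "- blinfun_apply \<alpha> x / blinfun_apply \<alpha> z \<le> q" if "\<alpha> \<in> Pos" for \<alpha>
    using that finite_Pos by (auto simp: q_def)
  have "q \<in> (\<lambda>\<alpha>. - blinfun_apply \<alpha> x / blinfun_apply \<alpha> z) ` Pos"
    unfolding q_def using assms finite_Pos by (intro Max_in) auto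
  then obtain \<alpha> where \<alpha>: "\<alpha> \<in> Pos" "q = - blinfun_apply \<alpha> x / blinfun_apply \<alpha> z" by auto
  have "0 < - blinfun_apply \<gamma> x / blinfun_apply \<gamma> z" using assms z(1) by (simp add: divide_neg_pos)
  then have "q > 0" using le[OF assms(1)] by linarith
  define y where "y = x + q *\<^sub>R z"
  have y: "blinfun_apply \<beta> y = blinfun_apply \<beta> x + q * blinfun_apply \<beta> z" for \<beta>
    by (simp add: y_def blinfun.add_right blinfun.scaleR_right)
  have y0: "blinfun_apply \<alpha> y = 0" using \<alpha> z(1)[of \<alpha>] by (simp add: y)
  then have neg: "blinfun_apply \<alpha> x < 0"
    using \<open>q > 0\<close> z(1)[OF \<alpha>(1)] y[of \<alpha>] by (smt (verit) mult_pos_pos)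
  have "blinfun_apply \<beta> y > 0" if \<beta>: "\<beta> \<in> Pos" "\<nexists>c. \<beta> = c *\<^sub>R \<alpha>" for \<beta>
  proof (rule ccontr)
    assume "\<not> blinfun_apply \<beta> y > 0"
    moreover have "blinfun_apply \<beta> y \<ge> 0"
      using le[OF \<beta>(1)] z(1)[OF \<beta>(1)] by (simp add: y field_simps)
    ultimately have "blinfun_apply \<beta> y = 0" by simp
    then have eqs: "blinfun_apply \<beta> x = - q * blinfun_apply \<beta> z" "blinfun_apply \<alpha> x = - q * blinfun_apply \<alpha> z"
      using y0 y by (simp_all add: eq_neg_iff_add_eq_0)
    define f where "f = blinfun_apply \<beta> x *\<^sub>R \<alpha> - blinfun_apply \<alpha> x *\<^sub>R \<beta>"
    have "blinfun_apply f z = 0"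
      by (simp add: f_def blinfun.diff_left blinfun.scaleR_left eqs)
    then have "f \<notin> F" using z(2) by blast
    then have "f = 0" using \<alpha>(1) \<beta>(1) by (force simp: F_def f_def)
    then have "blinfun_apply \<alpha> x *\<^sub>R \<beta> = blinfun_apply \<beta> x *\<^sub>R \<alpha>" by (simp add: f_def)
    then have "\<beta> = (blinfun_apply \<beta> x / blinfun_apply \<alpha> x) *\<^sub>R \<alpha>"
      using neg by (metis (no_types, lifting) divide_inverse_commute less_irrefl scaleR_scaleR
          scaleR_one left_inverse)
    then show False using \<beta>(2) by blast
  qed
  then have "wall \<alpha>" using \<alpha>(1) y0 by (auto simp: wall_def)
  then show ?thesis using that neg by blast
qed

abbreviation word :: "('a \<Rightarrow>\<^sub>L real) list \<Rightarrow> 'a \<Rightarrow> 'a" where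
  "word \<equiv> foldr reflection"

abbreviation root_word :: "('a \<Rightarrow>\<^sub>L real) list \<Rightarrow> ('a \<Rightarrow>\<^sub>L real) \<Rightarrow> ('a \<Rightarrow>\<^sub>L real)" where
  "root_word \<equiv> foldr reflect_root"

lemma wall_nonzero: "wall \<alpha> \<Longrightarrow> \<alpha> \<noteq> 0"
  using Pos_subset root_nonzero by (auto simp: wall_def)

lemma root_word_word:
  "set \<alpha>s \<subseteq> Collect wall \<Longrightarrow>
    blinfun_apply (root_word \<alpha>s \<beta>) (word \<alpha>s v) = blinfun_apply \<beta> v"
  by (induction \<alpha>s) (auto simp: apply_reflect_root wall_nonzero)

lemma reflection_root_word:
  "set \<alpha>s \<subseteq> Collect wall \<Longrightarrow>
    reflection (root_word \<alpha>s \<beta>) (word \<alpha>s v) = word \<alpha>s (reflection \<beta> v)"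
  by (induction \<alpha>s) (auto simp: reflection_reflect_root wall_nonzero)

text \<open>
  Let \<open>g\<close> be the element given by the word \<open>\<alpha>s\<close>, and suppose that \<open>g \<alpha>\<close> is negative. Applying the
  letters to \<open>\<alpha>\<close> one by one, from the last to the first, some letter \<open>\<gamma>\<close> turns a positive root into
  a negative one. By \<open>reflect_root_wall_Pos\<close> that positive root is proportional to \<open>\<gamma>\<close>. So \<open>\<tau>\<^sub>\<gamma>\<close> is
  conjugate to \<open>\<tau>\<^sub>\<alpha>\<close> by the letters after \<open>\<gamma>\<close>, and it cancels against the final \<open>\<tau>\<^sub>\<alpha>\<close>.
\<close>

lemma word_deletion:
  assumes "set \<alpha>s \<subseteq> Collect wall" "wall \<alpha>" "root_word \<alpha>s \<alpha> \<notin> Pos"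
  shows "\<exists>\<beta>s. set \<beta>s \<subseteq> Collect wall \<and> length \<beta>s < length \<alpha>s \<and>
           (\<forall>v. word \<alpha>s (reflection \<alpha> v) = word \<beta>s v)"
  using assms
proof (induction \<alpha>s)
  case Nil
  then show ?case by (simp add: wall_def)
next
  case (Cons \<gamma> \<alpha>s)
  let ?\<beta> = "root_word \<alpha>s \<alpha>"
  have walls: "set \<alpha>s \<subseteq> Collect wall" "wall \<gamma>" using Cons.prems by auto
  show ?case
  proof (cases "?\<beta> \<in> Pos")
    case False
    then obtain \<beta>s where "set \<beta>s \<subseteq> Collect wall" "length \<beta>s < length \<alpha>s"
      "\<forall>v. word \<alpha>s (reflection \<alpha> v) = word \<beta>s v"
      using Cons.IH[OF walls(1) Cons.prems(2)] by blast
    then show ?thesis using walls(2) by (intro exI[of _ "\<gamma> # \<beta>s"]) auto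
  next
    case True
    then obtain c where c: "?\<beta> = c *\<^sub>R \<gamma>"
      using reflect_root_wall_Pos[OF walls(2) True] Cons.prems(3) by auto
    have "?\<beta> \<noteq> 0" using True Pos_subset root_nonzero by blast
    then have "c \<noteq> 0" using c by auto
    then have "reflection \<gamma> = reflection ?\<beta>" by (simp add: c reflection_scaleR)
    then have "word (\<gamma> # \<alpha>s) (reflection \<alpha> v) = word \<alpha>s v" for v
      using Cons.prems(2) by (simp add: reflection_root_word[OF walls(1)] wall_nonzero)
    then show ?thesis using walls(1) by (intro exI[of _ \<alpha>s]) simp
  qed
qed

text \<open>
  Induction on the length of the word. Write it as \<open>g \<tau>\<^sub>\<alpha>\<close>. If \<open>g \<alpha>\<close> is negative, the word can be
  shortened by deletion. If \<open>g \<alpha>\<close> is positive, its value at the dominant vector \<open>g \<tau>\<^sub>\<alpha> v\<close>, which is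
  \<open>- \<alpha>(v)\<close>, is nonnegative. Since \<open>\<alpha>(v) \<ge> 0\<close> as well, \<open>\<tau>\<^sub>\<alpha>\<close> fixes \<open>v\<close> and can be dropped.
\<close>

lemma word_dominant_eq:
  assumes "set \<alpha>s \<subseteq> Collect wall" "dominant v" "dominant (word \<alpha>s v)"
  shows "word \<alpha>s v = v"
  using assms
proof (induction "length \<alpha>s" arbitrary: \<alpha>s rule: less_induct)
  case less
  show ?case
  proof (cases \<alpha>s rule: rev_cases)
    case Nil
    then show ?thesis by simp
  next
    case (snoc \<beta>s \<alpha>)
    have walls: "set \<beta>s \<subseteq> Collect wall" "wall \<alpha>" using less.prems snoc by auto
    have eq: "word \<alpha>s v = word \<beta>s (reflection \<alpha> v)" by (simp add: snoc)
    show ?thesis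
    proof (cases "root_word \<beta>s \<alpha> \<in> Pos")
      case True
      then have "blinfun_apply (root_word \<beta>s \<alpha>) (word \<alpha>s v) \<ge> 0"
        using less.prems(3) by (auto simp: dominant_def)
      then have "blinfun_apply \<alpha> (reflection \<alpha> v) \<ge> 0"
        by (simp add: eq root_word_word[OF walls(1)])
      moreover have "blinfun_apply \<alpha> v \<ge> 0"
        using less.prems(2) walls(2) by (auto simp: dominant_def wall_def)
      ultimately have "blinfun_apply \<alpha> v = 0"
        using root_coroot[OF wall_nonzero[OF walls(2)]]
        by (simp add: reflection_def blinfun.diff_right blinfun.scaleR_right)
      then have "word \<alpha>s v = word \<beta>s v" by (simp add: eq reflection_def)
      then show ?thesis using less.hyps[of \<beta>s] less.prems walls snoc by simp
    next
      case False
      then obtain \<gamma>s where "set \<gamma>s \<subseteq> Collect wall" "length \<gamma>s < length \<beta>s"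
        "\<forall>v. word \<beta>s (reflection \<alpha> v) = word \<gamma>s v"
        using word_deletion walls by blast
      then show ?thesis using less.hyps[of \<gamma>s] less.prems snoc eq by simp
    qed
  qed
qed

text \<open>
  Wall reflections generate all reflections, by induction on the height of the root: as \<open>- \<beta>\<^sup>\<or>\<close>
  violates dominance, some wall \<open>\<alpha>\<close> has \<open>\<alpha>(\<beta>\<^sup>\<or>) > 0\<close>, hence \<open>\<beta>(\<alpha>\<^sup>\<or>) > 0\<close>. Then the reflected root
  is lower than \<open>\<beta>\<close>, and \<open>\<tau>\<^sub>\<beta>\<close> is conjugate to its reflection by \<open>\<tau>\<^sub>\<alpha>\<close>.
\<close>

lemma reflection_Pos_eq_word:
  assumes "\<beta> \<in> Pos"
  shows "\<exists>\<alpha>s. set \<alpha>s \<subseteq> Collect wall \<and> reflection \<beta> = word \<alpha>s"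
  using assms
proof (induction rule: Pos_induct)
  case (less \<beta>)
  have "\<beta> \<noteq> 0" using less.hyps Pos_subset root_nonzero by auto
  then have "blinfun_apply \<beta> (- coroot \<beta>) < 0" by (simp add: blinfun.minus_right root_coroot)
  then obtain \<alpha> where \<alpha>: "wall \<alpha>" "blinfun_apply \<alpha> (- coroot \<beta>) < 0"
    using exists_separating_wall less.hyps by blast
  then have "blinfun_apply \<alpha> (coroot \<beta>) > 0" by (simp add: blinfun.minus_right)
  then have pos: "blinfun_apply \<beta> (coroot \<alpha>) > 0" by (rule apply_coroot_pos_sym)
  show ?case
  proof (cases "\<exists>c. \<beta> = c *\<^sub>R \<alpha>")
    case True
    then have "reflection \<beta> = reflection \<alpha>" using \<open>\<beta> \<noteq> 0\<close> by (auto simp: reflection_scaleR)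
    then show ?thesis using \<alpha>(1) by (intro exI[of _ "[\<alpha>]"]) auto
  next
    case False
    then have mem: "reflect_root \<alpha> \<beta> \<in> Pos"
      using reflect_root_wall_Pos \<alpha>(1) less.hyps by blast
    have "blinfun_apply (reflect_root \<alpha> \<beta>) \<rho> < blinfun_apply \<beta> \<rho>"
      using pos \<alpha>(1) by (simp add: reflect_root_def blinfun.diff_left blinfun.scaleR_left wall_def Pos_def)
    then obtain \<alpha>s where \<alpha>s: "set \<alpha>s \<subseteq> Collect wall" "reflection (reflect_root \<alpha> \<beta>) = word \<alpha>s"
      using less.IH mem by blast
    have "word (\<alpha> # \<alpha>s @ [\<alpha>]) v = reflection \<alpha> (reflection (reflect_root \<alpha> \<beta>) (reflection \<alpha> v))" for v
      by (simp add: \<alpha>s(2))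
    moreover have "reflection \<alpha> (reflection (reflect_root \<alpha> \<beta>) (reflection \<alpha> v)) = reflection \<beta> v" for v
      using \<alpha>(1) by (simp add: reflection_reflect_root wall_nonzero)
    ultimately have "reflection \<beta> = word (\<alpha> # \<alpha>s @ [\<alpha>])" by (metis ext)
    then show ?thesis using \<alpha>(1) \<alpha>s(1) by (intro exI[of _ "\<alpha> # \<alpha>s @ [\<alpha>]"]) auto
  qed
qed

lemma weyl_group_eq_word:
  assumes "w \<in> weyl_group R"
  shows "\<exists>\<alpha>s. set \<alpha>s \<subseteq> Collect wall \<and> w = word \<alpha>s"
  using assms unfolding weyl_group_def
proof (induction rule: generated_group.induct)
  case id
  then show ?case by (intro exI[of _ "[]"]) auto
next
  case (step s w)
  then obtain \<alpha> \<alpha>s where \<alpha>: "\<alpha> \<in> R" "s = reflection \<alpha>" "set \<alpha>s \<subseteq> Collect wall" "w = word \<alpha>s"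
    by auto
  have "reflection (- \<alpha>) = reflection \<alpha>" using reflection_scaleR[of "-1" \<alpha>] by simp
  then obtain \<beta>s where "set \<beta>s \<subseteq> Collect wall" "s = word \<beta>s"
    using \<alpha>(1,2) reflection_Pos_eq_word by (metis root_cases)
  then show ?case using \<alpha>(3,4) by (intro exI[of _ "\<beta>s @ \<alpha>s"]) auto
qed

lemma weyl_group_dominant_eq:
  assumes "w \<in> weyl_group R" "dominant v" "dominant (w v)"
  shows "w v = v"
  using weyl_group_eq_word[OF assms(1)] word_dominant_eq assms(2,3) by blast

lemma weyl_orbitI: "w \<in> weyl_group R \<Longrightarrow> w v \<in> weyl_orbit R v"
  by (simp add: weyl_orbit_def)

lemma linear_weyl_group: "w \<in> weyl_group R \<Longrightarrow> linear w"
  unfolding weyl_group_def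
proof (induction rule: generated_group.induct)
  case (step s w)
  then show ?case using linear_reflection linear_compose by blast
qed (rule linear_id)

lemma reflection_in_weyl_group: "\<alpha> \<in> R \<Longrightarrow> reflection \<alpha> \<in> weyl_group R"
  using generated_group.step[OF imageI generated_group.id, of \<alpha> R reflection]
  by (simp add: weyl_group_def)

lemma weyl_group_comp: "w \<in> weyl_group R \<Longrightarrow> w' \<in> weyl_group R \<Longrightarrow> w \<circ> w' \<in> weyl_group R"
  unfolding weyl_group_def
  by (induction rule: generated_group.induct) (auto simp: comp_assoc intro: generated_group.step)

lemma weyl_group_inverse:
  "w \<in> weyl_group R \<Longrightarrow> \<exists>w'\<in>weyl_group R. \<forall>v. w' (w v) = v"
  unfolding weyl_group_def
proof (induction rule: generated_group.induct)
  case id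
  then show ?case by (auto intro!: bexI[OF _ generated_group.id])
next
  case (step s w)
  then obtain \<alpha> w' where s: "\<alpha> \<in> R" "s = reflection \<alpha>" and
    w': "w' \<in> weyl_group R" "\<forall>v. w' (w v) = v" by (auto simp: weyl_group_def)
  have "w' \<circ> reflection \<alpha> \<in> weyl_group R"
    using weyl_group_comp reflection_in_weyl_group s w' by blast
  then show ?case
    using s w'(2) root_nonzero by (intro bexI[of _ "w' \<circ> reflection \<alpha>"]) (auto simp: weyl_group_def)
qed

lemma root_weyl_group:
  "w \<in> weyl_group R \<Longrightarrow> \<alpha> \<in> R \<Longrightarrow> \<exists>\<beta>\<in>R. \<forall>v. blinfun_apply \<alpha> (w v) = blinfun_apply \<beta> v"
  unfolding weyl_group_def
proof (induction arbitrary: \<alpha> rule: generated_group.induct)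
  case id
  then show ?case by auto
next
  case (step s w)
  then obtain \<gamma> where \<gamma>: "\<gamma> \<in> R" "s = reflection \<gamma>" by auto
  then show ?case
    using step.IH[OF reflect_root_in[OF \<gamma>(1) step.prems]] by (simp add: apply_reflect_root)
qed

text \<open>
  The roots span the dual space, so a vector is determined by the values of the roots at it; along an
  orbit these are values of roots at \<open>v\<close>.
\<close>

lemma finite_weyl_orbit: "finite (weyl_orbit R v)"
proof -
  define f where "f u = (\<lambda>\<alpha>\<in>R. blinfun_apply \<alpha> u)" for u
  have "f ` weyl_orbit R v \<subseteq> R \<rightarrow>\<^sub>E (\<lambda>\<beta>. blinfun_apply \<beta> v) ` R"
    using root_weyl_group by (fastforce simp: f_def weyl_orbit_def)
  then have fin: "finite (f ` weyl_orbit R v)"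
    using finite_R by (meson finite_PiE finite_imageI finite_subset)
  have "inj f"
  proof (rule injI)
    fix x y assume "f x = f y"
    then have 0: "blinfun_apply \<alpha> (x - y) = 0" if "\<alpha> \<in> R" for \<alpha>
      using that by (metis (no_types, lifting) blinfun.diff_right diff_self f_def restrict_apply')
    have span: "span R = UNIV" using root_system by (simp add: root_system_def)
    have "blinfun_apply \<alpha> (x - y) = 0" for \<alpha> :: "'a \<Rightarrow>\<^sub>L real"
    proof -
      have "\<alpha> \<in> span R" using span by simp
      then show ?thesis
        by (induction rule: span_induct_alt)
           (auto simp: 0 blinfun.add_left blinfun.scaleR_left)
    qed
    from this[of "Blinfun (\<lambda>v. v \<bullet> (x - y))"] show "x = y"
      by (simp add: bounded_linear_Blinfun_apply[OF bounded_linear_inner_left])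
  qed
  then show ?thesis using fin finite_imageD inj_on_subset by blast
qed

text \<open>
  An orbit element \<open>u\<close> with maximal inner product with \<open>\<rho>\<close> is dominant: if a positive root \<open>\<alpha>\<close> were
  negative at \<open>u\<close>, reflecting would add a positive multiple of \<open>\<alpha>\<^sup>\<or>\<close>, which has positive inner
  product with \<open>\<rho>\<close>.
\<close>

lemma exists_dominant: "\<exists>w\<in>weyl_group R. dominant (w v)"
proof -
  let ?h = "(\<lambda>x. x \<bullet> \<rho>) ` weyl_orbit R v"
  have fin: "finite ?h" using finite_weyl_orbit by simp
  have "?h \<noteq> {}" by (auto simp: weyl_orbit_def weyl_group_def intro: generated_group.id)
  then obtain u where u: "u \<in> weyl_orbit R v" "Max ?h = u \<bullet> \<rho>"
    using Max_in[OF fin] by auto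
  have max: "x \<bullet> \<rho> \<le> u \<bullet> \<rho>" if "x \<in> weyl_orbit R v" for x
    using Max_ge[OF fin] that by (simp flip: u(2))
  obtain w where w: "w \<in> weyl_group R" "u = w v" using u(1) by (auto simp: weyl_orbit_def)
  have "blinfun_apply \<alpha> u \<ge> 0" if "\<alpha> \<in> Pos" for \<alpha>
  proof (rule ccontr)
    assume neg: "\<not> blinfun_apply \<alpha> u \<ge> 0"
    have \<alpha>: "\<alpha> \<in> R" "\<rho> \<bullet> coroot \<alpha> > 0" using that by (auto simp: Pos_def inner_coroot_pos)
    have "reflection \<alpha> u \<in> weyl_orbit R v"
      using weyl_orbitI[OF weyl_group_comp[OF reflection_in_weyl_group[OF \<alpha>(1)] w(1)]] w(2) by simp
    then have "reflection \<alpha> u \<bullet> \<rho> \<le> u \<bullet> \<rho>" by (rule max)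
    then have "blinfun_apply \<alpha> u * (\<rho> \<bullet> coroot \<alpha>) \<ge> 0"
      by (simp add: reflection_def inner_diff_left inner_commute[of \<rho>])
    then show False using neg \<alpha>(2) by (simp add: zero_le_mult_iff)
  qed
  then show ?thesis using w by (auto simp: dominant_def)
qed

lemma ex1_dominant_in_weyl_orbit: "\<exists>!u. dominant u \<and> u \<in> weyl_orbit R v"
proof -
  obtain w where w: "w \<in> weyl_group R" "dominant (w v)" using exists_dominant by blast
  show ?thesis
  proof (rule ex1I[of _ "w v"])
    show "dominant (w v) \<and> w v \<in> weyl_orbit R v" using w by (auto simp: weyl_orbit_def)
  next
    fix u assume u: "dominant u \<and> u \<in> weyl_orbit R v"
    then obtain w1 where w1: "w1 \<in> weyl_group R" "u = w1 v" by (auto simp: weyl_orbit_def)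
    obtain w' where w': "w' \<in> weyl_group R" "w' (w v) = v" using weyl_group_inverse w(1) by blast
    have "(w1 \<circ> w') (w v) = w v"
      using weyl_group_dominant_eq[OF weyl_group_comp[OF w1(1) w'(1)] w(2)] u w1(2) w'(2) by simp
    then show "u = w v" using w1(2) w'(2) by simp
  qed
qed

lemma delta_dist_dominant:
  "dominant (delta_dist R (Collect dominant) x y) \<and>
    delta_dist R (Collect dominant) x y \<in> weyl_orbit R (y - x)"
  unfolding delta_dist_def mem_Collect_eq by (rule theI'[OF ex1_dominant_in_weyl_orbit])

lemma dominant_scaleR: "c \<ge> 0 \<Longrightarrow> dominant v \<Longrightarrow> dominant (c *\<^sub>R v)"
  by (simp add: dominant_def blinfun.scaleR_right)

lemma pos_roots_eq_Pos: "pos_roots R (Collect dominant) = Pos"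
proof -
  have "dominant \<rho>" by (auto simp: dominant_def Pos_def)
  then have "blinfun_apply \<alpha> \<rho> > 0" if "\<alpha> \<in> R" "\<forall>v\<in>Collect dominant. blinfun_apply \<alpha> v \<ge> 0" for \<alpha>
    using that(2) regular[OF that(1)] by force
  then have "pos_roots R (Collect dominant) \<subseteq> Pos" by (auto simp: pos_roots_def Pos_def)
  moreover have "Pos \<subseteq> pos_roots R (Collect dominant)"
    using Pos_subset by (auto simp: pos_roots_def dominant_def)
  ultimately show ?thesis by blast
qed

lemma coweight_lattice_weyl_orbit:
  assumes "v \<in> coweight_lattice R" "u \<in> weyl_orbit R v"
  shows "u \<in> coweight_lattice R"
proof -
  obtain w where w: "w \<in> weyl_group R" "u = w v" using assms(2) by (auto simp: weyl_orbit_def)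
  have "blinfun_apply \<alpha> u \<in> \<int>" if \<alpha>: "\<alpha> \<in> R" for \<alpha>
    using root_weyl_group[OF w(1) \<alpha>] assms(1) w(2) by (auto simp: coweight_lattice_def)
  then show ?thesis by (simp add: coweight_lattice_def)
qed

text \<open>
  By induction on height: a positive root is simple, where the value is \<open>0\<close> or \<open>1\<close> by definition, or
  a sum of two lower positive roots.
\<close>

lemma fundamental_coweight_in_lattice:
  assumes "v \<in> fundamental_coweights R (Collect dominant)"
  shows "v \<in> coweight_lattice R"
proof -
  have int_Pos: "blinfun_apply \<alpha> v \<in> \<int>" if "\<alpha> \<in> Pos" for \<alpha>
    using that
  proof (induction rule: Pos_induct)
    case (less \<alpha>)
    show ?case
    proof (cases "\<alpha> \<in> simple_roots R (Collect dominant)")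
      case True
      then have "blinfun_apply \<alpha> v = 0 \<or> blinfun_apply \<alpha> v = 1"
        using assms by (force simp: fundamental_coweights_def)
      then show ?thesis by auto
    next
      case False
      then obtain \<beta> \<gamma> where \<beta>\<gamma>: "\<beta> \<in> Pos" "\<gamma> \<in> Pos" "\<alpha> = \<beta> + \<gamma>"
        using less.hyps by (auto simp: simple_roots_def pos_roots_eq_Pos)
      then have "blinfun_apply \<beta> v \<in> \<int>" "blinfun_apply \<gamma> v \<in> \<int>"
        by (auto intro!: less.IH simp: Pos_def blinfun.add_left)
      then show ?thesis using \<beta>\<gamma> by (simp add: blinfun.add_left)
    qed
  qed
  have "blinfun_apply \<alpha> v \<in> \<int>" if "\<alpha> \<in> R" for \<alpha>
    using that
  proof (cases rule: root_cases)
    case 2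
    then show ?thesis using int_Pos[of "- \<alpha>"] by (simp add: blinfun.minus_left)
  qed (rule int_Pos)
  then show ?thesis by (simp add: coweight_lattice_def)
qed

lemma weyl_orbit_sym:
  assumes "u \<in> weyl_orbit R v"
  shows "v \<in> weyl_orbit R u"
proof -
  obtain w where w: "w \<in> weyl_group R" "u = w v" using assms by (auto simp: weyl_orbit_def)
  then obtain w' where "w' \<in> weyl_group R" "w' u = v" using weyl_group_inverse by blast
  then show ?thesis using weyl_orbitI by blast
qed

lemma weyl_orbit_scaleR: "u \<in> weyl_orbit R v \<Longrightarrow> c *\<^sub>R u \<in> weyl_orbit R (c *\<^sub>R v)"
  using linear_weyl_group by (force simp: weyl_orbit_def linear_cmul)

end

text \<open>
  The component of \<open>\<rho>\<close> is the open cone on which all positive roots are positive: the cone is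
  convex, and a connected set avoiding a hyperplane stays on one side of it. Adding small multiples of
  \<open>\<rho>\<close> shows that the closure consists of all dominant vectors.
\<close>

lemma weyl_chamber_eq_dominant:
  assumes "root_system R" "\<Delta> \<in> weyl_chambers R"
  obtains \<rho> where "regular_vector R \<rho>" "\<Delta> = Collect (regular_vector.dominant R \<rho>)"
proof -
  define U where "U = - (\<Union>\<alpha>\<in>R. {v. blinfun_apply \<alpha> v = 0})"
  obtain K where K: "K \<in> components U" "\<Delta> = closure K"
    using assms(2) by (auto simp: weyl_chambers_def U_def)
  then obtain \<rho> where \<rho>: "\<rho> \<in> U" "K = connected_component_set U \<rho>"
    by (auto elim: componentsE)
  interpret regular_vector R \<rho>
    using assms(1) \<rho>(1) by unfold_locales (auto simp: U_def)
  define C where "C = (\<Inter>\<alpha>\<in>Pos. {v. blinfun_apply \<alpha> v > 0})"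
  have rho_C: "\<rho> \<in> C" by (auto simp: C_def Pos_def)
  have "convex C"
    unfolding C_def apply_eq_inner_riesz inner_commute[of _ "riesz _"]
    by (intro convex_INT convex_halfspace_gt)
  have "C \<subseteq> U"
  proof
    fix v assume v: "v \<in> C"
    have "blinfun_apply \<alpha> v \<noteq> 0" if "\<alpha> \<in> R" for \<alpha>
      using that by (cases rule: root_cases) (use v in \<open>force simp: C_def blinfun.minus_left\<close>)+
    then show "v \<in> U" by (auto simp: U_def)
  qed
  then have "C \<subseteq> K"
    unfolding \<rho>(2) using rho_C convex_connected[OF \<open>convex C\<close>] by (intro connected_component_maximal)
  moreover have "K \<subseteq> C"
  proof
    fix v assume v: "v \<in> K"
    have "blinfun_apply \<alpha> v > 0" if \<alpha>: "\<alpha> \<in> Pos" for \<alpha>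
    proof (rule ccontr)
      assume "\<not> blinfun_apply \<alpha> v > 0"
      then have "riesz \<alpha> \<bullet> v \<le> 0" by (simp add: apply_eq_inner_riesz inner_commute)
      moreover have "0 \<le> riesz \<alpha> \<bullet> \<rho>"
        using \<alpha> by (simp add: Pos_def apply_eq_inner_riesz inner_commute)
      moreover have "connected K" "\<rho> \<in> K" using \<rho> by auto
      ultimately obtain z where "z \<in> K" "riesz \<alpha> \<bullet> z = 0"
        using connected_ivt_hyperplane[of K v \<rho>] v by blast
      moreover have "K \<subseteq> U" by (simp add: \<rho>(2) connected_component_subset)
      ultimately show False
        using \<alpha> Pos_subset by (auto simp: U_def apply_eq_inner_riesz inner_commute)
    qed
    then show "v \<in> C" by (simp add: C_def)
  qed
  ultimately have "K = C" by blast
  moreover have "closure C = Collect dominant"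
  proof
    have "closed {v. blinfun_apply \<alpha> v \<ge> 0}" for \<alpha> :: "'a \<Rightarrow>\<^sub>L real"
      by (intro closed_Collect_le continuous_intros)
    then have "closed (\<Inter>\<alpha>\<in>Pos. {v. blinfun_apply \<alpha> v \<ge> 0})" by blast
    moreover have "Collect dominant = (\<Inter>\<alpha>\<in>Pos. {v. blinfun_apply \<alpha> v \<ge> 0})"
      by (auto simp: dominant_def)
    ultimately have "closed (Collect dominant)" by simp
    then show "closure C \<subseteq> Collect dominant"
      by (intro closure_minimal) (auto simp: C_def dominant_def less_imp_le)
    show "Collect dominant \<subseteq> closure C"
    proof
      fix v assume v: "v \<in> Collect dominant"
      define x where "x n = v + inverse (real (Suc n)) *\<^sub>R \<rho>" for n
      have "x \<longlonglongrightarrow> v + 0 *\<^sub>R \<rho>"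
        unfolding x_def by (intro tendsto_intros LIMSEQ_inverse_real_of_nat)
      moreover have "x n \<in> C" for n
        using v by (auto simp: C_def x_def dominant_def Pos_def blinfun.add_right blinfun.scaleR_right
            intro!: add_nonneg_pos)
      ultimately show "v \<in> closure C" unfolding closure_sequential by auto
    qed
  qed
  ultimately show ?thesis using that[OF regular_vector_axioms] K(2) by simp
qed


section \<open>Rescaling chains\<close>

lemma weyl_chamber_scaleR:
  assumes "root_system R" "C \<in> weyl_chambers R" "v \<in> C" "c \<ge> 0"
  shows "c *\<^sub>R v \<in> C"
proof -
  obtain \<rho> where \<rho>: "regular_vector R \<rho>" "C = Collect (regular_vector.dominant R \<rho>)"
    using weyl_chamber_eq_dominant assms by blast
  then show ?thesis using regular_vector.dominant_scaleR assms(3,4) by blast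
qed

text \<open>
  The chain from \<open>\<nu>\<close> ends at a vector in the same closed chamber as \<open>\<mu>\<close>. The chain is rescaled by
  \<open>c\<close>, while \<open>\<mu>\<close> may be rescaled by a different factor, since chambers are cones. The roots of the
  chain are roots of \<open>R\<close>, so that the group \<open>W'\<close> may be replaced by \<open>W\<close>.
\<close>

lemma chain_gtrsim_scaleR:
  assumes "root_system R" "chain_gtrsim R \<Delta> W' \<nu> \<mu>" "c > 0" "d > 0"
  shows "chain_gtrsim R \<Delta> (weyl_group R) (c *\<^sub>R \<nu>) (d *\<^sub>R \<mu>)"
proof -
  obtain m \<eta> \<beta> C where ch: "is_chain R \<Delta> W' m \<eta> \<beta>" "\<eta> 0 = \<nu>"
    and C: "C \<in> weyl_chambers R" "\<eta> m \<in> C" "\<mu> \<in> C"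
    using assms(2) by (auto simp: chain_gtrsim_def chain_ge_def same_chamber_def)
  have "is_chain R \<Delta> (weyl_group R) m (\<lambda>i. c *\<^sub>R \<eta> i) \<beta>"
    unfolding is_chain_def
  proof (intro conjI allI impI ballI)
    fix i assume "i \<le> m"
    then show "c *\<^sub>R \<eta> i \<noteq> 0" using ch(1) assms(3) by (simp add: is_chain_def)
  next
    fix i assume "i \<in> {1..m}"
    then have i: "\<beta> i \<in> pos_roots R \<Delta>" "\<eta> i = reflection (\<beta> i) (\<eta> (i - 1))"
      "blinfun_apply (\<beta> i) (\<eta> (i - 1)) < 0"
      using ch(1) by (auto simp: is_chain_def)
    then have "\<beta> i \<in> R" by (simp add: pos_roots_def)
    then show "reflection (\<beta> i) \<in> weyl_group R"
      using generated_group.step[OF imageI generated_group.id, of "\<beta> i" R reflection]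
      by (simp add: weyl_group_def)
    show "\<beta> i \<in> pos_roots R \<Delta>" by (rule i)
    show "c *\<^sub>R \<eta> i = reflection (\<beta> i) (c *\<^sub>R \<eta> (i - 1))"
      by (simp add: i(2) linear_cmul[OF linear_reflection])
    show "blinfun_apply (\<beta> i) (c *\<^sub>R \<eta> (i - 1)) < 0"
      using i(3) assms(3) by (simp add: blinfun.scaleR_right mult_pos_neg)
  qed
  then have "chain_ge R \<Delta> (weyl_group R) (c *\<^sub>R \<nu>) (c *\<^sub>R \<eta> m)"
    using ch(2) by (auto simp: chain_ge_def)
  moreover have "same_chamber R (c *\<^sub>R \<eta> m) (d *\<^sub>R \<mu>)"
    unfolding same_chamber_def
    using C assms(3,4) by (intro bexI[OF _ C(1)] conjI weyl_chamber_scaleR[OF assms(1) C(1)]) auto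
  ultimately show ?thesis by (auto simp: chain_gtrsim_def)
qed

lemma ls_path_straight:
  assumes "l \<in> \<Delta> \<inter> coweight_lattice R" "u \<in> weyl_orbit R l"
  shows "ls_path R \<Delta> l (\<lambda>t. t *\<^sub>R u)"
  unfolding ls_path_def
  using assms
  by (auto intro!: exI[of _ "1::nat"] exI[of _ real] exI[of _ "\<lambda>_. u"])


section \<open>Affine pieces of piecewise-linear paths\<close>

lemma has_vector_derivative_affine:
  fixes p :: "real \<Rightarrow> 'a::real_normed_vector"
  assumes "\<And>s. s \<in> {a..b} \<Longrightarrow> p s = p a + (s - a) *\<^sub>R u" "x \<in> {a..b}"
  shows "(p has_vector_derivative u) (at x within {a..b})"
proof (rule has_vector_derivative_transform[OF assms(2)])
  show "((\<lambda>s. p a + (s - a) *\<^sub>R u) has_vector_derivative u) (at x within {a..b})"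
    by (auto intro!: derivative_eq_intros)
qed (rule assms(1))

lemma left_velocity_affine:
  assumes "a < b" "\<And>s. s \<in> {a..b} \<Longrightarrow> p s = p a + (s - a) *\<^sub>R u"
  shows "left_velocity p b = u"
  using vector_derivative_within_closed_interval[OF assms(1) _ has_vector_derivative_affine[OF assms(2)], of b]
    assms(1) by (simp add: left_velocity_def at_within_Icc_at_left)

lemma right_velocity_affine:
  assumes "a < b" "\<And>s. s \<in> {a..b} \<Longrightarrow> p s = p a + (s - a) *\<^sub>R u"
  shows "right_velocity p a = u"
  using vector_derivative_within_closed_interval[OF assms(1) _ has_vector_derivative_affine[OF assms(2)], of a]
    assms(1) by (simp add: right_velocity_def at_within_Icc_at_right)

text \<open>
  Used on both sides of a breakpoint, this shows that the slopes agree at a breakpoint where the path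
  is differentiable.
\<close>

lemma differentiable_affine_velocity:
  fixes p :: "real \<Rightarrow> 'a::euclidean_space"
  assumes "p differentiable (at x)" "a < b" "x \<in> {a..b}"
    "\<And>s. s \<in> {a..b} \<Longrightarrow> p s = p a + (s - a) *\<^sub>R u"
  shows "vector_derivative p (at x) = u"
proof -
  have "(p has_vector_derivative vector_derivative p (at x)) (at x within {a..b})"
    using assms(1) by (simp add: has_vector_derivative_at_within vector_derivative_works)
  then show ?thesis
    using vector_derivative_within_closed_interval[OF assms(2,3)] has_vector_derivative_affine[OF assms(4,3)]
    by metis
qed

lemma exists_partition_interval:
  fixes t :: "nat \<Rightarrow> real"
  assumes "t 0 \<le> x" "x < t n"
  shows "\<exists>i<n. t i \<le> x \<and> x < t (Suc i)"
  using assms(2)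
proof (induction n)
  case (Suc n)
  then show ?case by (cases "x < t n") (auto intro: less_SucI)
qed (use assms in simp)

lemma pl_path_affine_between:
  assumes "pl_path p" "0 \<le> a" "a < b" "b \<le> 1"
    and diff: "\<And>x. x \<in> {a<..<b} \<Longrightarrow> p differentiable (at x)"
  shows "\<exists>u. \<forall>s\<in>{a..b}. p s = p a + (s - a) *\<^sub>R u"
proof -
  obtain n t u where t: "t 0 = 0" "t n = 1" "\<And>i. i < n \<Longrightarrow> t i < t (Suc i)"
    and u: "\<And>i s. i < n \<Longrightarrow> s \<in> {t i..t (Suc i)} \<Longrightarrow> p s = p (t i) + (s - t i) *\<^sub>R u i"
    using assms(1) unfolding pl_path_def by metis
  obtain i where i: "i < n" "t i \<le> a" "a < t (Suc i)"
    using exists_partition_interval[of t a n] t assms by auto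
  \<comment> \<open>The slope \<open>u i\<close> of the piece that contains \<open>a\<close> persists across each breakpoint \<open>t j\<close> before \<open>b\<close>.\<close>
  have "a < t j \<and> (\<forall>s\<in>{a..min b (t j)}. p s = p a + (s - a) *\<^sub>R u i)" if "Suc i \<le> j" "j \<le> n" for j
    using that
  proof (induction j rule: dec_induct)
    case base
    have a: "a \<in> {t i..t (Suc i)}" using i by simp
    have "p s = p a + (s - a) *\<^sub>R u i" if s: "s \<in> {a..t (Suc i)}" for s
    proof -
      have "s \<in> {t i..t (Suc i)}" using s i(2) by simp
      from u[OF i(1) this] show ?thesis unfolding u[OF i(1) a] by (simp add: algebra_simps)
    qed
    then show ?case using i(3) by (metis atLeastAtMost_iff min.bounded_iff)
  next
    case (step j)
    have j: "j < n" using step.prems by simp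
    have IH: "a < t j" "\<And>s. s \<in> {a..min b (t j)} \<Longrightarrow> p s = p a + (s - a) *\<^sub>R u i"
      using step.IH[OF less_imp_le[OF j]] by blast+
    show ?case
    proof (cases "b \<le> t j")
      case True
      then have "min b (t j) = b" "min b (t (Suc j)) = b" "a < t (Suc j)" using IH(1) t(3)[OF j] by auto
      then show ?thesis using IH(2) by (simp only:) blast
    next
      case False
      have aff: "p s = p a + (s - a) *\<^sub>R u i" if "s \<in> {a..t j}" for s
        by (rule IH(2)) (use that False in simp)
      have d: "p differentiable (at (t j))" using diff IH(1) False by auto
      have mem: "t j \<in> {a..t j}" "t j \<in> {t j..t (Suc j)}" using IH(1) t(3)[OF j] by auto
      have "u j = u i"
        using differentiable_affine_velocity[OF d IH(1) mem(1) aff]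
          differentiable_affine_velocity[OF d t(3)[OF j] mem(2) u[OF j]] by metis
      then have "p s = p a + (s - a) *\<^sub>R u i" if "s \<in> {t j..t (Suc j)}" for s
        unfolding u[OF j that] aff[OF mem(1)] by (simp add: algebra_simps)
      then show ?thesis using aff IH(1) t(3)[OF j]
        by (metis atLeastAtMost_iff less_trans linorder_le_cases min.bounded_iff)
    qed
  qed
  from this[OF Suc_leI[OF i(1)] order_refl]
  have "\<forall>s\<in>{a..min b 1}. p s = p a + (s - a) *\<^sub>R u i" unfolding t(2) by (rule conjunct2)
  moreover have "min b 1 = b" using assms(4) by simp
  ultimately show ?thesis by metis
qed

lemma finite_nondifferentiable:
  assumes "pl_path p"
  shows "finite {x\<in>{0<..<1}. \<not> p differentiable (at x)}"
proof -
  obtain n t u where t: "t 0 = 0" "t n = 1" "\<And>i. i < n \<Longrightarrow> t i < t (Suc i)"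
    and u: "\<And>i s. i < n \<Longrightarrow> s \<in> {t i..t (Suc i)} \<Longrightarrow> p s = p (t i) + (s - t i) *\<^sub>R u i"
    using assms unfolding pl_path_def by metis
  have "x \<in> t ` {..n}" if x: "x \<in> {0<..<1}" "\<not> p differentiable (at x)" for x
  proof (rule ccontr)
    assume nt: "x \<notin> t ` {..n}"
    obtain i where i: "i < n" "t i \<le> x" "x < t (Suc i)"
      using exists_partition_interval[of t x n] t x by auto
    have "t i \<noteq> x" using nt i(1) by auto
    then have "t i < x" using i(2) by simp
    then have "at x within {t i..t (Suc i)} = at x" using i(3) by (rule at_within_Icc_at)
    moreover have "(p has_vector_derivative u i) (at x within {t i..t (Suc i)})"
      by (rule has_vector_derivative_affine[OF u[OF i(1)]]) (use i in simp_all)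
    ultimately have "(p has_vector_derivative u i) (at x)" by simp
    then have "p differentiable (at x)" by (rule differentiableI_vector)
    then show False using x(2) by blast
  qed
  then have "{x\<in>{0<..<1}. \<not> p differentiable (at x)} \<subseteq> t ` {..n}" by blast
  then show ?thesis by (rule finite_subset) simp
qed

lemma vertex_times_properties:
  assumes "pl_path p"
  shows "sorted_wrt (<) (vertex_times p)"
    and "set (vertex_times p) = {0, 1} \<union> {x\<in>{0<..<1}. \<not> p differentiable (at x)}"
proof -
  let ?T = "{0, 1} \<union> {x\<in>{0<..<1}. \<not> p differentiable (at x)}"
  have "finite ?T" using finite_nondifferentiable[OF assms] by blast
  then show "sorted_wrt (<) (vertex_times p)" "set (vertex_times p) = ?T"
    unfolding vertex_times_def by (simp_all only: strict_sorted_list_of_set set_sorted_list_of_set)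
qed

definition affine_piece :: "(real \<Rightarrow> 'a::real_vector) \<Rightarrow> real \<Rightarrow> real \<Rightarrow> bool" where
  "affine_piece q x y \<longleftrightarrow> x < y \<and> (\<forall>s\<in>{x..y}. q s - q x = ((s - x) / (y - x)) *\<^sub>R (q y - q x))"

lemma affine_pieceD:
  assumes "affine_piece q x y" "s \<in> {x..y}"
  shows "q s = q x + (s - x) *\<^sub>R ((1 / (y - x)) *\<^sub>R (q y - q x))"
proof -
  have "q s - q x = ((s - x) / (y - x)) *\<^sub>R (q y - q x)"
    using assms unfolding affine_piece_def by blast
  then have "q s = q x + ((s - x) / (y - x)) *\<^sub>R (q y - q x)" by (metis add.commute diff_add_cancel)
  then show ?thesis by simp
qed

lemma affine_piece_vertex_times:
  assumes "pl_path p" "Suc i < length (vertex_times p)"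
  shows "affine_piece p (vertex_times p ! i) (vertex_times p ! Suc i)"
proof -
  let ?ts = "vertex_times p"
  define a where "a = ?ts ! i"
  define b where "b = ?ts ! Suc i"
  note ts = vertex_times_properties[OF assms(1)]
  have "a < b"
    using sorted_wrt_nth_less[OF ts(1), of i "Suc i"] assms(2) by (simp add: a_def b_def)
  have "a \<in> set ?ts" "b \<in> set ?ts" using assms(2) by (simp_all add: a_def b_def)
  then have bounds: "0 \<le> a" "b \<le> 1" by (auto simp: ts(2))
  have no_vertex: "x \<notin> set ?ts" if "x \<in> {a<..<b}" for x
  proof
    assume "x \<in> set ?ts"
    then obtain j where j: "j < length ?ts" "x = ?ts ! j" by (auto simp: in_set_conv_nth)
    have "\<not> j < i" "j \<noteq> i" "j \<noteq> Suc i" "\<not> Suc i < j"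
      using that sorted_wrt_nth_less[OF ts(1), of j i] sorted_wrt_nth_less[OF ts(1), of "Suc i" j] assms(2) j
      by (auto simp: a_def b_def)
    then show False by linarith
  qed
  have "p differentiable (at x)" if "x \<in> {a<..<b}" for x
    using no_vertex[OF that] that bounds by (auto simp: ts(2))
  then obtain u where u: "\<And>s. s \<in> {a..b} \<Longrightarrow> p s = p a + (s - a) *\<^sub>R u"
    using pl_path_affine_between[OF assms(1) bounds(1) \<open>a < b\<close> bounds(2)] by blast
  have "p b - p a = (b - a) *\<^sub>R u" using u[of b] \<open>a < b\<close> by simp
  then have "p s - p a = ((s - a) / (b - a)) *\<^sub>R (p b - p a)" if "s \<in> {a..b}" for s
    using u[OF that] \<open>a < b\<close> by simp
  then show ?thesis
    using \<open>a < b\<close> unfolding affine_piece_def a_def[symmetric] b_def[symmetric] by blast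
qed


section \<open>Polygons as concatenations of segments\<close>

definition segment_vectors :: "(real \<Rightarrow> 'a::euclidean_space) \<Rightarrow> real list \<Rightarrow> 'a list" where
  "segment_vectors q ts = map (\<lambda>(x, y). q y - q x) (zip ts (tl ts))"

text \<open>
  A concatenation runs through its first path on \<open>[0, 1/2]\<close> and through the rest on \<open>[1/2, 1]\<close>.
  Accordingly the parameter change \<open>\<phi>\<close> maps the first piece \<open>[a, b]\<close> linearly onto \<open>[0, 1/2]\<close>, and on
  the remaining interval it is the parameter change \<open>\<psi>\<close> of the remaining polygon, squeezed into
  \<open>[1/2, 1]\<close>.
\<close>

lemma polygon_eq_path_concat_list:
  fixes q :: "real \<Rightarrow> 'a::euclidean_space"
  assumes "successively (affine_piece q) (a # b # ts)"
  shows "a < last (b # ts) \<and>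
    (\<exists>\<phi>. continuous_on {a..last (b # ts)} \<phi> \<and> strict_mono_on {a..last (b # ts)} \<phi> \<and>
       \<phi> a = 0 \<and> \<phi> (last (b # ts)) = 1 \<and>
       (\<forall>s\<in>{a..last (b # ts)}. q s - q a =
          path_concat_list (map (\<lambda>v t. t *\<^sub>R v) (segment_vectors q (a # b # ts))) (\<phi> s)))"
  using assms
proof (induction ts arbitrary: a b)
  case Nil
  then have "affine_piece q a b" by simp
  then have ab: "a < b" and q: "\<And>s. s \<in> {a..b} \<Longrightarrow> q s - q a = ((s - a) / (b - a)) *\<^sub>R (q b - q a)"
    unfolding affine_piece_def by blast+
  define \<phi> where "\<phi> s = (s - a) / (b - a)" for s
  have "continuous_on {a..b} \<phi>" "strict_mono_on {a..b} \<phi>" "\<phi> a = 0" "\<phi> b = 1"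
    using ab by (auto simp: \<phi>_def[abs_def] divide_strict_right_mono
        intro!: continuous_intros strict_mono_onI)
  moreover have "path_concat_list (map (\<lambda>v t. t *\<^sub>R v) (segment_vectors q [a, b])) (\<phi> s) = q s - q a"
    if "s \<in> {a..b}" for s
    unfolding q[OF that] by (simp add: segment_vectors_def \<phi>_def)
  ultimately show ?case using ab by auto
next
  case (Cons c ts)
  define L where "L = last (c # ts)"
  have "affine_piece q a b" using Cons.prems by simp
  then have ab: "a < b" and q: "\<And>s. s \<in> {a..b} \<Longrightarrow> q s - q a = ((s - a) / (b - a)) *\<^sub>R (q b - q a)"
    unfolding affine_piece_def by blast+
  define P where "P = path_concat_list (map (\<lambda>v t. t *\<^sub>R v) (segment_vectors q (b # c # ts)))"
  have "successively (affine_piece q) (b # c # ts)" using Cons.prems by simp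
  from Cons.IH[OF this] obtain \<psi> where bL: "b < L" and cont: "continuous_on {b..L} \<psi>"
    and mono: "strict_mono_on {b..L} \<psi>" and \<psi>: "\<psi> b = 0" "\<psi> L = 1"
    and P: "\<And>s. s \<in> {b..L} \<Longrightarrow> q s - q b = P (\<psi> s)"
    by (auto simp: L_def P_def)
  have \<psi>_pos: "\<psi> s > 0" if "b < s" "s \<le> L" for s
    using strict_mono_onD[OF mono, of b s] that \<psi>(1) by simp
  define \<phi> where "\<phi> s = (if s \<le> b then (s - a) / (b - a) / 2 else 1 / 2 + \<psi> s / 2)" for s
  have "continuous_on ({a..b} \<union> {b..L}) \<phi>"
    unfolding \<phi>_def using ab \<psi>(1)
    by (intro continuous_on_If) (auto intro!: continuous_intros cont)
  then have "continuous_on {a..L} \<phi>" using ab bL by (simp add: ivl_disj_un_two_touch)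
  moreover have "strict_mono_on {a..L} \<phi>"
  proof (rule strict_mono_onI)
    fix r s assume rs: "r \<in> {a..L}" "s \<in> {a..L}" "r < s"
    consider "s \<le> b" | "r \<le> b" "b < s" | "b < r" by linarith
    then show "\<phi> r < \<phi> s"
    proof cases
      case 1
      then show ?thesis using rs ab by (simp add: \<phi>_def divide_strict_right_mono)
    next
      case 2
      then have "(r - a) / (b - a) \<le> 1" using ab by simp
      then have "(r - a) / (b - a) / 2 \<le> 1 / 2" by (rule divide_right_mono) simp
      also have "\<dots> < 1 / 2 + \<psi> s / 2" using \<psi>_pos[of s] 2 rs by simp
      finally have "(r - a) / (b - a) / 2 < 1 / 2 + \<psi> s / 2" .
      then show ?thesis using 2 by (simp add: \<phi>_def)
    next
      case 3
      then show ?thesis using rs strict_mono_onD[OF mono, of r s] by (simp add: \<phi>_def)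
    qed
  qed
  moreover have "\<phi> a = 0" "\<phi> L = 1" using ab bL \<psi>(2) by (simp_all add: \<phi>_def)
  moreover have "q s - q a = path_concat (\<lambda>t. t *\<^sub>R (q b - q a)) P (\<phi> s)" if s: "s \<in> {a..L}" for s
  proof (cases "s \<le> b")
    case True
    define x where "x = (s - a) / (b - a)"
    have "x \<le> 1" "\<phi> s = x / 2" using True ab by (simp_all add: x_def \<phi>_def)
    then have "path_concat (\<lambda>t. t *\<^sub>R (q b - q a)) P (\<phi> s) = x *\<^sub>R (q b - q a)"
      by (simp add: path_concat_def joinpaths_def)
    moreover have "q s - q a = x *\<^sub>R (q b - q a)" unfolding x_def by (rule q) (use s True in simp)
    ultimately show ?thesis by (simp only:)
  next
    case False
    have "\<psi> s > 0" using \<psi>_pos s False by simp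
    then have "path_concat (\<lambda>t. t *\<^sub>R (q b - q a)) P (\<phi> s) = q b - q a + P (\<psi> s)"
      using False by (simp add: \<phi>_def path_concat_def joinpaths_def pathfinish_def)
    moreover have "P (\<psi> s) = q s - q b" by (rule P[symmetric]) (use s False in simp)
    ultimately show ?thesis by simp
  qed
  moreover have concat: "path_concat_list (map (\<lambda>v t. t *\<^sub>R v) (segment_vectors q (a # b # c # ts)))
      = path_concat (\<lambda>t. t *\<^sub>R (q b - q a)) P"
    by (simp add: segment_vectors_def P_def)
  moreover have "a < L" "last (b # c # ts) = L" using ab bL by (simp_all add: L_def)
  ultimately show ?case unfolding concat by (metis (no_types, lifting))
qed


section \<open>Dilations of generalized Hecke paths\<close>

lemma generalized_ls_path_dilation:
  fixes R :: "('a::euclidean_space \<Rightarrow>\<^sub>L real) set" and k :: nat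
  assumes R: "root_system R" and \<Delta>: "\<Delta> \<in> weyl_chambers R"
    and p: "generalized_hecke_path R \<Delta> p" "p 0 = 0"
  shows "generalized_ls_path R \<Delta> (real k *\<^sub>R delta_length R \<Delta> p) (\<lambda>t. real k *\<^sub>R p t)"
proof -
  obtain \<rho> where \<rho>: "regular_vector R \<rho>" and \<Delta>_eq: "\<Delta> = Collect (regular_vector.dominant R \<rho>)"
    using weyl_chamber_eq_dominant R \<Delta> by blast
  interpret regular_vector R \<rho> by (rule \<rho>)
  show ?thesis
  proof (cases "k = 0")
    case True
    have "0 \<in> \<Delta> \<inter> coweight_lattice R"
      by (simp add: \<Delta>_eq dominant_def coweight_lattice_def)
    moreover have "0 \<in> weyl_orbit R 0"
      by (auto simp: weyl_orbit_def weyl_group_def intro!: image_eqI[OF _ generated_group.id])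
    ultimately have "ls_path R \<Delta> 0 (\<lambda>t. t *\<^sub>R 0)" by (rule ls_path_straight)
    moreover have "reparametrization (\<lambda>t. 0 :: 'a) (\<lambda>t. 0)"
      unfolding reparametrization_def
      by (intro exI[of _ "\<lambda>t. t"]) (auto intro: strict_mono_onI)
    ultimately show ?thesis
      unfolding generalized_ls_path_def
      using True by (intro exI[of _ "[\<lambda>t. 0]"] exI[of _ "[0]"]) simp
  next
    case False
    define q where "q t = real k *\<^sub>R p t" for t
    define ts where "ts = vertex_times p"
    have pl: "pl_path p" using p(1) by (simp add: generalized_hecke_path_def)
    note ts = vertex_times_properties[OF pl, folded ts_def]
    define vs where "vs = segment_vectors q ts"
    define ps where "ps = map (\<lambda>v t. t *\<^sub>R v) vs"
    define ls where "ls = map (\<lambda>(x, y). real k *\<^sub>R delta_dist R \<Delta> x y) (geodesic_segments p)"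
    have segs: "geodesic_segments p = map (\<lambda>(x, y). (p x, p y)) (zip ts (tl ts))"
      by (simp add: geodesic_segments_def Let_def ts_def map_tl[symmetric] zip_map_map)
    have len: "length vs = length ts - 1" "length ps = length ts - 1" "length ls = length ts - 1"
      by (simp_all add: ps_def ls_def segs vs_def segment_vectors_def)
    have tl_ts: "tl ts ! i = ts ! Suc i" if "Suc i < length ts" for i
      using that by (simp add: nth_tl)
    have vs_nth: "vs ! i = real k *\<^sub>R (p (ts ! Suc i) - p (ts ! i))"
      and seg_nth: "geodesic_segments p ! i = (p (ts ! i), p (ts ! Suc i))"
      if "Suc i < length ts" for i
      using that by (simp_all add: vs_def segment_vectors_def segs q_def tl_ts scaleR_diff_right)
    have ps_nth: "ps ! i = (\<lambda>t. t *\<^sub>R vs ! i)"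
      and ls_nth: "ls ! i = real k *\<^sub>R delta_dist R \<Delta> (p (ts ! i)) (p (ts ! Suc i))"
      if "Suc i < length ts" for i
      using that seg_nth[OF that] by (simp_all add: ps_def ls_def len segs)
    have piece: "affine_piece p (ts ! i) (ts ! Suc i)" if "Suc i < length ts" for i
      using affine_piece_vertex_times[OF pl] that by (simp add: ts_def)
    have "affine_piece q (ts ! i) (ts ! Suc i)" if "Suc i < length ts" for i
      using piece[OF that] unfolding affine_piece_def q_def
      by (metis (no_types, lifting) scaleR_left_commute scaleR_diff_right)
    then have succ: "successively (affine_piece q) ts"
      by (simp add: successively_conv_nth)
    have 01: "0 \<in> set ts" "1 \<in> set ts" and bounds: "set ts \<subseteq> {0..1}" by (auto simp: ts(2))
    obtain a b ts' where ts_eq: "ts = a # b # ts'"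
      using 01 by (cases ts rule: remdups_adj.cases) auto
    have "sorted ts" using ts(1) by (rule strict_sorted_imp_sorted)
    have "a = 0"
      using 01(1) bounds \<open>sorted ts\<close> by (force simp: ts_eq)
    have last: "last (b # ts') = 1"
    proof -
      have "last ts \<in> set ts" by (simp add: ts_eq)
      then have "last ts \<le> 1" using bounds by auto
      moreover have "1 \<le> last ts"
        using \<open>sorted ts\<close> 01(2) by (cases ts rule: rev_cases) (auto simp: sorted_append)
      ultimately show ?thesis by (simp add: ts_eq)
    qed
    have reparam: "reparametrization (path_concat_list ps) q"
      using polygon_eq_path_concat_list[OF succ[unfolded ts_eq]] p(2)
      unfolding last \<open>a = 0\<close> reparametrization_def
      by (auto simp: ps_def vs_def ts_eq \<open>a = 0\<close> q_def)
    have "ls_path R \<Delta> (ls ! i) (ps ! i)" if "i < length ps" for i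
    proof -
      have i: "Suc i < length ts" using that len by simp
      define v where "v = p (ts ! Suc i) - p (ts ! i)"
      define d where "d = delta_dist R \<Delta> (p (ts ! i)) (p (ts ! Suc i))"
      have "geodesic_segments p ! i \<in> set (geodesic_segments p)"
        using i by (intro nth_mem) (simp add: segs)
      then obtain m :: int and w \<omega> where w: "w \<in> weyl_group R" and
        \<omega>: "\<omega> \<in> fundamental_coweights R \<Delta>" "v = of_int m *\<^sub>R w \<omega>"
        using p(1) unfolding seg_nth[OF i] generalized_hecke_path_def v_def by blast
      have "w \<omega> \<in> coweight_lattice R"
        using coweight_lattice_weyl_orbit[OF fundamental_coweight_in_lattice weyl_orbitI[OF w]] \<omega>(1)
        by (simp add: \<Delta>_eq)
      then have kv: "real k *\<^sub>R v \<in> coweight_lattice R"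
        by (simp add: \<omega>(2) coweight_lattice_def blinfun.scaleR_right)
      have d: "dominant d" "d \<in> weyl_orbit R v"
        using delta_dist_dominant by (auto simp: d_def v_def \<Delta>_eq)
      have orb: "real k *\<^sub>R d \<in> weyl_orbit R (real k *\<^sub>R v)" by (rule weyl_orbit_scaleR[OF d(2)])
      then have "real k *\<^sub>R d \<in> \<Delta> \<inter> coweight_lattice R"
        using coweight_lattice_weyl_orbit[OF kv] dominant_scaleR[OF _ d(1)] by (simp add: \<Delta>_eq)
      from ls_path_straight[OF this weyl_orbit_sym[OF orb]] show ?thesis
        by (simp add: ps_nth[OF i] ls_nth[OF i] vs_nth[OF i] d_def v_def)
    qed
    moreover have "chain_gtrsim R \<Delta> (weyl_group R)
        (left_velocity (ps ! i) 1) (right_velocity (ps ! Suc i) 0)" if "Suc i < length ps" for i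
    proof -
      have i: "Suc i < length ts" "Suc (Suc i) < length ts" using that len by auto
      let ?a = "ts ! i" and ?b = "ts ! Suc i" and ?c = "ts ! Suc (Suc i)"
      have ab: "?a < ?b" and bc: "?b < ?c" using piece i by (auto simp: affine_piece_def)
      \<comment> \<open>\<open>?b\<close> is an interior vertex, so the chain condition holds there; the velocities on its two
        sides differ from the dilated segment vectors by positive factors.\<close>
      have "?a \<in> set ts" "?c \<in> set ts" using i by auto
      then have "?b \<in> {0<..<1}" using ab bc bounds by force
      then have "chain_gtrsim R \<Delta> (stabilizer R (p ?b)) (left_velocity p ?b) (right_velocity p ?b)"
        using p(1) by (simp add: generalized_hecke_path_def chain_condition_def)
      then have "chain_gtrsim R \<Delta> (weyl_group R)
          ((real k * (?b - ?a)) *\<^sub>R left_velocity p ?b) ((real k * (?c - ?b)) *\<^sub>R right_velocity p ?b)"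
        using False ab bc by (intro chain_gtrsim_scaleR[OF R]) auto
      moreover have "left_velocity p ?b = (1 / (?b - ?a)) *\<^sub>R (p ?b - p ?a)"
        by (rule left_velocity_affine[OF ab affine_pieceD[OF piece[OF i(1)]]])
      moreover have "right_velocity p ?b = (1 / (?c - ?b)) *\<^sub>R (p ?c - p ?b)"
        by (rule right_velocity_affine[OF bc affine_pieceD[OF piece[OF i(2)]]])
      moreover have "left_velocity (\<lambda>t. t *\<^sub>R v) 1 = v" for v :: 'a
        by (rule left_velocity_affine[of 0]) simp_all
      moreover have "right_velocity (\<lambda>t. t *\<^sub>R v) 0 = v" for v :: 'a
        by (rule right_velocity_affine[of _ 1]) simp_all
      ultimately show ?thesis
        unfolding ps_nth[OF i(1)] ps_nth[OF i(2)] vs_nth[OF i(1)] vs_nth[OF i(2)]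
        using ab bc by (simp del: scaleR_scaleR add: scaleR_scaleR[of _ "1 / _"])
    qed
    moreover have "real k *\<^sub>R delta_length R \<Delta> p = sum_list ls"
    proof -
      have "real k *\<^sub>R sum_list (map f xs) = sum_list (map (\<lambda>x. real k *\<^sub>R f x) xs)"
        for f :: "'a \<times> 'a \<Rightarrow> 'a" and xs
        by (induction xs) (auto simp: scaleR_add_right)
      then show ?thesis by (simp add: delta_length_def ls_def case_prod_unfold)
    qed
    ultimately show ?thesis
      unfolding generalized_ls_path_def using reparam len ts_eq
      by (intro exI[of _ ps] exI[of _ ls]) (auto simp: q_def[abs_def])
  qed
qed

theorem theorem1p11:
  fixes R :: "('a::euclidean_space \<Rightarrow>\<^sub>L real) set"
    and \<Delta> :: "'a set"
    and p :: "real \<Rightarrow> 'a"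
  assumes "root_system R"
    and "\<Delta> \<in> weyl_chambers R"
    and "generalized_hecke_path R \<Delta> p"
    and "p 0 = 0"
  shows "generalized_ls_path R \<Delta>
           (real (saturation_factor R \<Delta>) *\<^sub>R delta_length R \<Delta> p)
           (\<lambda>t. real (saturation_factor R \<Delta>) *\<^sub>R p t)"
  using assms by (rule generalized_ls_path_dilation)

end
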